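(* Let $G\subseteq\mathrm{GL}(n)$ be a symmetric subgroup with $K=G\cap U(n)$, and let $\pi\colon G\to\mathrm{GL}(V)$ be a rational representation on a finite-dimensional complex vector space with a $K$-invariant Hermitian inner product. For any $v\in V\setminus\{0\}$, the function $F_v\colon G\to\mathbb R$, $F_v(g)=\log\|\pi(g)v\|$, is (geodesically) convex and $2N(\pi)^2$-smooth. Moreover, its geodesic Hessian is given by $$\operatorname{tr}\bigl[\nabla^2F_v(g)(H\otimes H)\bigr]=2\bigl(\langle u,\Pi(H)^2u\rangle-\langle u,\Pi(H)u\rangle^2\bigr)$$ for all $g\in G$ and $H\in i\mathrm{Lie}(K)$, where $u=\frac{\pi(g)v}{\|\pi(g)v\|}$.
   Context: Symmetric subgroup: a connected, Zariski-closed subgroup $G\subseteq\mathrm{GL}(n)$ (over $\mathbb C$) with $g^\dagger\in G$ for all $g\in G$. $\mathrm{Lie}(K)=\{X:e^{tX}\in K\ \forall t\in\mathbb R\}$, so $i\mathrm{Lie}(K)\subseteq\mathrm{Herm}(n)$. Rational representation: a homomorphism whose matrix entries are polynomials in the $g_{i,j}$ and $\det(g)^{-1}$; $\pi(K)$ acts by unitary maps; inner products are linear in the second argument. $\Pi(H)=\partial_{t=0}\pi(e^{tH})$ is the Lie algebra representation. Weight norm: $N(\pi)=\max\{\|\Pi(H)\|_{\mathrm{op}}:H\in i\mathrm{Lie}(K),\|H\|_F=1\}$. For a sufficiently differentiable function $F\colon G\to\mathbb R$ that is left-$K$-invariant ($F(kg)=F(g)$ for $k\in K$): $F$ is convex if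 $\partial_t^2F(e^{tH}g)\ge0$, and $L$-smooth if $|\partial_t^2F(e^{tH}g)|\le L\|H\|_F^2$, for all $H\in i\mathrm{Lie}(K)$, $g\in G$, $t\in\mathbb R$. The geodesic Hessian $\nabla^2F(g)\in\mathrm{Sym}^2(i\mathrm{Lie}(K))$ is defined by $\operatorname{tr}[\nabla^2F(g)(H\otimes H)]=\partial^2_{t=0}F(e^{tH}g)$ for all $H\in i\mathrm{Lie}(K)$. *)

theory Defs
  imports "HOL-Analysis.Analysis"
begin

section \<open>Complex matrices\<close>

text \<open>On \<open>complex^'n^'n\<close> the library's \<open>*\<close>, \<open>^\<close> and \<open>1\<close> act entrywise, so powers
  and the exponential are built from \<open>**\<close> and \<open>mat 1\<close>. The library's \<open>norm\<close> and
  \<open>\<bullet>\<close> on this type are the Frobenius norm and the real inner product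
  \<open>Re (tr (X\<^sup>\<dagger> Y))\<close>; on Hermitian matrices the latter is \<open>tr (X Y)\<close>.\<close>

definition mexp :: "complex^'n^'n \<Rightarrow> complex^'n^'n" where
  "mexp A = (\<Sum>k. (((**) A) ^^ k) (mat 1) /\<^sub>R fact k)"

definition conj_transpose :: "complex^'n^'n \<Rightarrow> complex^'n^'n" where
  "conj_transpose A = map_matrix cnj (transpose A)"

definition unitary_group :: "(complex^'n^'n) set" where
  "unitary_group = {U. conj_transpose U ** U = mat 1}"


section \<open>Symmetric subgroups\<close>

inductive_set poly_in :: "('a \<Rightarrow> complex) set \<Rightarrow> ('a \<Rightarrow> complex) set"
  for S :: "('a \<Rightarrow> complex) set" where
  gen: "f \<in> S \<Longrightarrow> f \<in> poly_in S"
| const: "(\<lambda>_. c) \<in> poly_in S"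
| add: "f \<in> poly_in S \<Longrightarrow> g \<in> poly_in S \<Longrightarrow> (\<lambda>x. f x + g x) \<in> poly_in S"
| mult: "f \<in> poly_in S \<Longrightarrow> g \<in> poly_in S \<Longrightarrow> (\<lambda>x. f x * g x) \<in> poly_in S"

definition entry_functions :: "(complex^'n^'n \<Rightarrow> complex) set" where
  "entry_functions = {\<lambda>g. g $ i $ j | i j. True}"

text \<open>Closed in the subspace topology of \<open>GL(n)\<close>; allowing \<open>det(g)\<^sup>-\<^sup>1\<close> in the equations
  gives the same sets, since it can be cleared on \<open>GL(n)\<close>.\<close>

definition zariski_closed_GL :: "(complex^'n^'n) set \<Rightarrow> bool" where
  "zariski_closed_GL G \<longleftrightarrow>
     (\<exists>P \<subseteq> poly_in entry_functions. G = {g. invertible g \<and> (\<forall>p\<in>P. p g = 0)})"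

text \<open>\<open>connected\<close> is meant in the Euclidean topology; for Zariski-closed subgroups of
  \<open>GL(n)\<close> over the complex numbers this agrees with Zariski connectedness.\<close>

definition symmetric_subgroup :: "(complex^'n^'n) set \<Rightarrow> bool" where
  "symmetric_subgroup G \<longleftrightarrow>
     zariski_closed_GL G \<and> connected G \<and>
     mat 1 \<in> G \<and> (\<forall>g\<in>G. \<forall>h\<in>G. g ** h \<in> G) \<and> (\<forall>g\<in>G. matrix_inv g \<in> G) \<and>
     (\<forall>g\<in>G. conj_transpose g \<in> G)"

definition Lie_alg :: "(complex^'n^'n) set \<Rightarrow> (complex^'n^'n) set" where
  "Lie_alg K = {X. \<forall>t::real. mexp (t *\<^sub>R X) \<in> K}"

definition iLie :: "(complex^'n^'n) set \<Rightarrow> (complex^'n^'n) set" where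
  "iLie K = (\<lambda>X. map_matrix ((*) \<i>) X) ` Lie_alg K"


section \<open>Representations on a Hermitian space\<close>

text \<open>A finite-dimensional complex vector space with an arbitrary Hermitian inner product,
  linear in the second argument. \<open>Basis\<close> is any basis, not assumed orthonormal.\<close>

locale hermitian_space = finite_dimensional_vector_space smul Basis
  for smul :: "complex \<Rightarrow> 'v::ab_group_add \<Rightarrow> 'v" and Basis :: "'v set" +
  fixes ip :: "'v \<Rightarrow> 'v \<Rightarrow> complex"
  assumes ip_add_right: "ip x (y + z) = ip x y + ip x z"
    and ip_scale_right: "ip x (smul c y) = c * ip x y"
    and ip_commute: "ip x y = cnj (ip y x)"
    and ip_pos: "x \<noteq> 0 \<Longrightarrow> 0 < Re (ip x x)"

definition hnorm :: "('v \<Rightarrow> 'v \<Rightarrow> complex) \<Rightarrow> 'v \<Rightarrow> real" where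
  "hnorm ip x = sqrt (Re (ip x x))"

text \<open>Same shape as the library's \<open>onorm\<close>.\<close>

definition hop_norm :: "('v \<Rightarrow> 'v \<Rightarrow> complex) \<Rightarrow> ('v \<Rightarrow> 'v) \<Rightarrow> real" where
  "hop_norm ip L = (SUP x. hnorm ip (L x) / hnorm ip x)"

text \<open>\<open>module.representation smul B (\<pi> g b') b\<close> is the \<open>(b, b')\<close> matrix entry of \<open>\<pi> g\<close>
  with respect to the basis \<open>B\<close>.\<close>

definition rational_representation ::
  "(complex \<Rightarrow> 'v::ab_group_add \<Rightarrow> 'v) \<Rightarrow> 'v set \<Rightarrow> (complex^'n^'n) set
    \<Rightarrow> (complex^'n^'n \<Rightarrow> 'v \<Rightarrow> 'v) \<Rightarrow> bool" where
  "rational_representation smul B G \<pi> \<longleftrightarrow>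
     (\<forall>g\<in>G. Vector_Spaces.linear smul smul (\<pi> g) \<and> bij (\<pi> g)) \<and>
     (\<forall>g\<in>G. \<forall>h\<in>G. \<pi> (g ** h) = \<pi> g \<circ> \<pi> h) \<and>
     (\<forall>b\<in>B. \<forall>b'\<in>B. \<exists>f \<in> poly_in (insert (\<lambda>g. inverse (det g)) entry_functions).
        \<forall>g\<in>G. module.representation smul B (\<pi> g b') b = f g)"

text \<open>\<open>\<Pi>(H) w\<close> is the derivative at \<open>t = 0\<close> of \<open>t \<mapsto> \<pi>(e\<^sup>t\<^sup>H) w\<close>, in the topology of the
  norm \<open>hnorm ip\<close> on \<open>V\<close>.\<close>

definition lie_rep ::
  "(complex \<Rightarrow> 'v::ab_group_add \<Rightarrow> 'v) \<Rightarrow> ('v \<Rightarrow> 'v \<Rightarrow> complex)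
    \<Rightarrow> (complex^'n^'n \<Rightarrow> 'v \<Rightarrow> 'v) \<Rightarrow> complex^'n^'n \<Rightarrow> 'v \<Rightarrow> 'v" where
  "lie_rep smul ip \<pi> H w =
     (THE w'. ((\<lambda>t::real. hnorm ip
        (smul (inverse (of_real t)) (\<pi> (mexp (t *\<^sub>R H)) w - \<pi> (mat 1) w) - w')) \<longlongrightarrow> 0) (at 0))"

text \<open>The maximum over a compact set, written as a supremum. If \<open>iLie K = {0}\<close> the set is
  empty and the value is irrelevant: it is only ever multiplied by \<open>(norm H)\<^sup>2\<close> with \<open>H \<in> iLie K\<close>.\<close>

definition weight_norm ::
  "(complex \<Rightarrow> 'v::ab_group_add \<Rightarrow> 'v) \<Rightarrow> ('v \<Rightarrow> 'v \<Rightarrow> complex) \<Rightarrow> (complex^'n^'n) set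
    \<Rightarrow> (complex^'n^'n \<Rightarrow> 'v \<Rightarrow> 'v) \<Rightarrow> real" where
  "weight_norm smul ip K \<pi> =
     (SUP H \<in> {H \<in> iLie K. norm H = 1}. hop_norm ip (lie_rep smul ip \<pi> H))"


section \<open>Geodesic convexity, smoothness and Hessian\<close>

definition along :: "(complex^'n^'n \<Rightarrow> real) \<Rightarrow> complex^'n^'n \<Rightarrow> complex^'n^'n \<Rightarrow> real \<Rightarrow> real" where
  "along F H g = (\<lambda>t. F (mexp (t *\<^sub>R H) ** g))"

definition left_invariant ::
  "(complex^'n^'n) set \<Rightarrow> (complex^'n^'n) set \<Rightarrow> (complex^'n^'n \<Rightarrow> real) \<Rightarrow> bool" where
  "left_invariant G K F \<longleftrightarrow> (\<forall>k\<in>K. \<forall>g\<in>G. F (k ** g) = F g)"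

text \<open>\<open>deriv\<close> is unspecified where the derivative does not exist, so differentiability along
  the curves \<open>t \<mapsto> e\<^sup>t\<^sup>H g\<close> is required explicitly.\<close>

definition twice_differentiable_along ::
  "(complex^'n^'n) set \<Rightarrow> (complex^'n^'n) set \<Rightarrow> (complex^'n^'n \<Rightarrow> real) \<Rightarrow> bool" where
  "twice_differentiable_along G K F \<longleftrightarrow>
     (\<forall>H\<in>iLie K. \<forall>g\<in>G. \<forall>t. along F H g differentiable (at t) \<and>
                              deriv (along F H g) differentiable (at t))"

definition geodesically_convex ::
  "(complex^'n^'n) set \<Rightarrow> (complex^'n^'n) set \<Rightarrow> (complex^'n^'n \<Rightarrow> real) \<Rightarrow> bool" where
  "geodesically_convex G K F \<longleftrightarrow>
     left_invariant G K F \<and> twice_differentiable_along G K F \<and>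
     (\<forall>H\<in>iLie K. \<forall>g\<in>G. \<forall>t. 0 \<le> deriv (deriv (along F H g)) t)"

definition geodesically_smooth ::
  "(complex^'n^'n) set \<Rightarrow> (complex^'n^'n) set \<Rightarrow> real \<Rightarrow> (complex^'n^'n \<Rightarrow> real) \<Rightarrow> bool" where
  "geodesically_smooth G K L F \<longleftrightarrow>
     left_invariant G K F \<and> twice_differentiable_along G K F \<and>
     (\<forall>H\<in>iLie K. \<forall>g\<in>G. \<forall>t. \<bar>deriv (deriv (along F H g)) t\<bar> \<le> L * (norm H)\<^sup>2)"

text \<open>Tensors of rank two over a Euclidean space \<open>E\<close> are identified with operators on \<open>E\<close>:
  \<open>x \<otimes> y\<close> is \<open>z \<mapsto> (y \<bullet> z) x\<close>. In characteristic 0 the symmetric tensors over a subspace \<open>W\<close>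
  are the span of the squares \<open>x \<otimes> x\<close> with \<open>x \<in> W\<close>.\<close>

definition tensor2 :: "'a::euclidean_space \<Rightarrow> 'a \<Rightarrow> 'a \<Rightarrow>\<^sub>L 'a" where
  "tensor2 x y = blinfun_scaleR_left x o\<^sub>L blinfun_inner_right y"

definition Sym2 :: "'a::euclidean_space set \<Rightarrow> ('a \<Rightarrow>\<^sub>L 'a) set" where
  "Sym2 W = span {tensor2 x x | x. x \<in> W}"

definition op_trace :: "('a::euclidean_space \<Rightarrow>\<^sub>L 'a) \<Rightarrow> real" where
  "op_trace A = (\<Sum>b\<in>Basis. b \<bullet> A b)"

lemma op_trace_tensor2: "op_trace (A o\<^sub>L tensor2 x y) = y \<bullet> A x"
proof -
  have "op_trace (A o\<^sub>L tensor2 x y) = (\<Sum>b\<in>Basis. (y \<bullet> b) * (A x \<bullet> b))"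
    by (simp add: op_trace_def tensor2_def blinfun.scaleR_right inner_commute)
  then show ?thesis
    using euclidean_inner [of y "A x"] by metis
qed

definition is_geodesic_hessian ::
  "(complex^'n^'n) set \<Rightarrow> (complex^'n^'n \<Rightarrow> real) \<Rightarrow> complex^'n^'n
    \<Rightarrow> ((complex^'n^'n) \<Rightarrow>\<^sub>L (complex^'n^'n)) \<Rightarrow> bool" where
  "is_geodesic_hessian K F g A \<longleftrightarrow>
     A \<in> Sym2 (iLie K) \<and>
     (\<forall>H\<in>iLie K. op_trace (A o\<^sub>L tensor2 H H) = deriv (deriv (along F H g)) 0)"

definition geodesic_hessian ::
  "(complex^'n^'n) set \<Rightarrow> (complex^'n^'n \<Rightarrow> real) \<Rightarrow> complex^'n^'n
    \<Rightarrow> ((complex^'n^'n) \<Rightarrow>\<^sub>L (complex^'n^'n))" where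
  "geodesic_hessian K F g = (THE A. is_geodesic_hessian K F g A)"


definition log_norm_orbit ::
  "('v \<Rightarrow> 'v \<Rightarrow> complex) \<Rightarrow> (complex^'n^'n \<Rightarrow> 'v \<Rightarrow> 'v) \<Rightarrow> 'v \<Rightarrow> complex^'n^'n \<Rightarrow> real" where
  "log_norm_orbit ip \<pi> v g = ln (hnorm ip (\<pi> g v))"

end

theory Submission
  imports Defs "HOL-Complex_Analysis.Complex_Analysis"
begin

text \<open>Fix \<open>H \<in> i Lie(K)\<close> and follow \<open>x(t) = \<pi>(e\<^sup>t\<^sup>H g) v\<close>, a solution of \<open>x' = \<Pi>(H) x\<close>. The maps
\<open>\<pi>(k)\<close>, \<open>k \<in> K\<close>, are unitary, so \<open>\<Pi>\<close> sends \<open>Lie(K)\<close> to skew-Hermitian operators, and since \<open>\<Pi>\<close> is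
complex linear, \<open>\<Pi>(H)\<close> is Hermitian (\<open>drep_hermitian\<close>). Differentiating \<open>log \<parallel>x(t)\<parallel>\<close> twice
then gives twice the variance of the observable \<open>\<Pi>(H)\<close> in the state \<open>u = x(t) / \<parallel>x(t)\<parallel>\<close>
(\<open>deriv_deriv_log_norm\<close>). A variance is nonnegative by Cauchy-Schwarz, which is convexity, and at
most \<open>\<parallel>\<Pi>(H) u\<parallel>\<^sup>2 \<le> (N(\<pi>) \<parallel>H\<parallel>)\<^sup>2\<close>, which is smoothness. As a function of \<open>H\<close> it is the
diagonal of the covariance form, hence a quadratic form on \<open>i Lie(K)\<close>, and quadratic forms
correspond bijectively to symmetric tensors (\<open>Sym2_representing_form\<close>, \<open>Sym2_eqI\<close>); this is the
Hessian.

Behind this lie three facts on \<open>G\<close> and \<open>\<pi>\<close>. First, \<open>e\<^sup>z\<^sup>X \<in> G\<close> for all complex \<open>z\<close> once it holds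
for real \<open>z\<close>: the equations of \<open>G\<close> become entire functions of \<open>z\<close> that vanish on the real line
(\<open>mexp_cscale_in_zariski_closed\<close>). So the curves \<open>e\<^sup>t\<^sup>H\<close> stay in \<open>G\<close>. Second, \<open>Lie(K)\<close> is closed
under addition, by the Lie product formula and closedness of \<open>K\<close> (\<open>Lie_alg_add\<close>). Third, every
matrix coefficient \<open>\<langle>a, \<pi>(g) w\<rangle>\<close> agrees on \<open>G\<close> with a function that is rational, hence complex
differentiable, on all of \<open>GL(n)\<close>; its derivative at the identity is complex linear in the
direction. The map \<open>\<Pi>\<close> is built from these derivatives (\<open>drep\<close>), which makes its linearity
in \<open>H\<close> immediate, and with it the finiteness of \<open>N(\<pi>)\<close>, a supremum of operator norms
\<open>\<parallel>\<Pi>(H)\<parallel>\<close> over the unit sphere.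

The vector space carries no topology of its own. Curves in it are differentiated weakly, through
the scalar functions \<open>\<langle>a, x(t)\<rangle>\<close>; coordinates obtained from
Gram-Schmidt turn this into convergence in norm.\<close>

section \<open>The matrix exponential\<close>

lemma bounded_bilinear_matrix_mult:
  "bounded_bilinear ((**) :: complex^'n^'n \<Rightarrow> complex^'n^'n \<Rightarrow> complex^'n^'n)"
proof -
  have "bilinear ((**) :: complex^'n^'n \<Rightarrow> complex^'n^'n \<Rightarrow> complex^'n^'n)"
    unfolding bilinear_def
    by (auto intro!: linearI simp: vec_eq_iff matrix_matrix_mult_def algebra_simps sum.distrib
        scaleR_sum_right)
  then show ?thesis
    by (simp add: bilinear_conv_bounded_bilinear)
qed

interpretation matrix_mult: bounded_bilinear
  "(**) :: complex^'n^'n \<Rightarrow> complex^'n^'n \<Rightarrow> complex^'n^'n"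
  by (rule bounded_bilinear_matrix_mult)

abbreviation cscale :: "complex \<Rightarrow> complex^'n^'n \<Rightarrow> complex^'n^'n" where
  "cscale c \<equiv> map_matrix ((*) c)"

definition matrix_power :: "complex^'n^'n \<Rightarrow> nat \<Rightarrow> complex^'n^'n" where
  "matrix_power A k = (((**) A) ^^ k) (mat 1)"

lemma matrix_power_0 [simp]: "matrix_power A 0 = mat 1"
  by (simp add: matrix_power_def)

lemma matrix_power_Suc [simp]: "matrix_power A (Suc k) = A ** matrix_power A k"
  by (simp add: matrix_power_def)

lemma matrix_power_Suc_right: "matrix_power A (Suc k) = matrix_power A k ** A"
  by (induction k) (simp_all add: matrix_mul_assoc)

lemma cscale_matrix_mult: "cscale c A ** cscale d B = cscale (c * d) (A ** B)"
  by (simp add: vec_eq_iff matrix_matrix_mult_def sum_distrib_left mult_ac)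

lemma matrix_power_cscale: "matrix_power (cscale z A) k = cscale (z ^ k) (matrix_power A k)"
  by (induction k) (simp_all add: cscale_matrix_mult, simp add: vec_eq_iff)

lemma norm_matrix_power_le:
  obtains C where "C \<ge> 0" "\<And>k. norm (matrix_power (A :: complex^'n^'n) k) \<le> norm (mat 1 :: complex^'n^'n) * C ^ k"
proof -
  obtain B where B: "B > 0" "\<And>(X :: complex^'n^'n) (Y :: complex^'n^'n). norm (X ** Y) \<le> norm X * norm Y * B"
    using matrix_mult.pos_bounded by blast
  have "norm (matrix_power A k) \<le> norm (mat 1 :: complex^'n^'n) * (norm A * B) ^ k" for k
  proof (induction k)
    case (Suc k)
    have "norm (matrix_power A (Suc k)) \<le> norm A * norm (matrix_power A k) * B"
      by (simp add: B)
    also have "\<dots> \<le> norm A * (norm (mat 1 :: complex^'n^'n) * (norm A * B) ^ k) * B"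
      using Suc B(1) by (intro mult_left_mono mult_right_mono) auto
    finally show ?case by (simp add: mult_ac)
  qed simp
  then show ?thesis
    using that[of "norm A * B"] B(1) by simp
qed

lemma summable_matrix_power:
  "summable (\<lambda>k. matrix_power (A :: complex^'n^'n) k /\<^sub>R fact k)"
proof -
  obtain C where C: "C \<ge> 0" "\<And>k. norm (matrix_power A k) \<le> norm (mat 1 :: complex^'n^'n) * C ^ k"
    using norm_matrix_power_le by blast
  show ?thesis
  proof (rule summable_comparison_test')
    show "summable (\<lambda>k. norm (mat 1 :: complex^'n^'n) * (C ^ k /\<^sub>R fact k))"
      using summable_exp_generic[of C] by (intro summable_mult) simp
    show "norm (matrix_power A k /\<^sub>R fact k) \<le> norm (mat 1 :: complex^'n^'n) * (C ^ k /\<^sub>R fact k)" for k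
      using C(2)[of k] by (simp add: field_simps)
  qed
qed

lemma mexp_entry_sums:
  "(\<lambda>k. (matrix_power A k $ i $ j) / fact k * z ^ k) sums (mexp (cscale z A) $ i $ j)"
proof -
  have "(\<lambda>k. matrix_power (cscale z A) k /\<^sub>R fact k) sums mexp (cscale z A)"
    unfolding mexp_def using summable_matrix_power[of "cscale z A"]
    by (simp add: summable_sums matrix_power_def)
  then have "(\<lambda>k. (matrix_power (cscale z A) k /\<^sub>R fact k) $ i $ j) sums (mexp (cscale z A) $ i $ j)"
    by (intro bounded_linear.sums[OF bounded_linear_vec_nth])
  then show ?thesis
    by (simp add: matrix_power_cscale scaleR_conv_of_real[where 'a=complex] field_simps)
qed

text \<open>Each entry of \<open>e\<^sup>z\<^sup>A\<close> is an everywhere convergent power series in the complex variable \<open>z\<close>.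
The coefficients \<open>A\<^sup>k\<^sup>+\<^sup>1 / k!\<close> of the derivative can be factored with \<open>A\<close> on either side, and both
forms are needed: the group law below comes from cancelling one against the other.\<close>

lemma mexp_entry_has_field_derivative:
  "((\<lambda>z. mexp (cscale z A) $ i $ j) has_field_derivative (A ** mexp (cscale z A)) $ i $ j) (at z)"
  "((\<lambda>z. mexp (cscale z A) $ i $ j) has_field_derivative (mexp (cscale z A) ** A) $ i $ j) (at z)"
proof -
  define c where "c k = (matrix_power A k $ i $ j) / fact k" for k
  have sums: "(\<lambda>k. c k * z ^ k) sums (mexp (cscale z A) $ i $ j)" for z
    unfolding c_def by (rule mexp_entry_sums)
  have eq: "mexp (cscale z A) $ i $ j = (\<Sum>k. c k * z ^ k)" for z
    using sums by (simp add: sums_iff)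
  have der: "((\<lambda>z. mexp (cscale z A) $ i $ j) has_field_derivative (\<Sum>k. diffs c k * z ^ k)) (at z)"
    unfolding eq using sums by (intro termdiffs_strong_converges_everywhere) (simp add: sums_iff)
  have diffs: "diffs c k = (matrix_power A (Suc k) $ i $ j) / fact k" for k
    by (simp add: diffs_def c_def del: of_nat_Suc)
  have "(\<lambda>k. \<Sum>l\<in>UNIV. A $ i $ l * ((matrix_power A k $ l $ j) / fact k * z ^ k))
      sums (\<Sum>l\<in>UNIV. A $ i $ l * mexp (cscale z A) $ l $ j)"
    by (intro sums_sum sums_mult mexp_entry_sums)
  then have "(\<lambda>k. diffs c k * z ^ k) sums (A ** mexp (cscale z A)) $ i $ j"
    unfolding diffs by (simp add: matrix_matrix_mult_def sum_divide_distrib sum_distrib_right sum_distrib_left mult_ac)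
  with der show "((\<lambda>z. mexp (cscale z A) $ i $ j) has_field_derivative (A ** mexp (cscale z A)) $ i $ j) (at z)"
    by (simp add: sums_iff)
  have "(\<lambda>k. \<Sum>l\<in>UNIV. ((matrix_power A k $ i $ l) / fact k * z ^ k) * A $ l $ j)
      sums (\<Sum>l\<in>UNIV. mexp (cscale z A) $ i $ l * A $ l $ j)"
    by (intro sums_sum sums_mult2 mexp_entry_sums)
  then have "(\<lambda>k. diffs c k * z ^ k) sums (mexp (cscale z A) ** A) $ i $ j"
    unfolding diffs matrix_power_Suc_right
    by (simp add: matrix_matrix_mult_def sum_divide_distrib sum_distrib_right sum_distrib_left mult_ac)
  with der show "((\<lambda>z. mexp (cscale z A) $ i $ j) has_field_derivative (mexp (cscale z A) ** A) $ i $ j) (at z)"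
    by (simp add: sums_iff)
qed

lemma has_vector_derivative_vec:
  fixes f :: "real \<Rightarrow> 'a::real_normed_vector^'m"
  assumes "\<And>i. ((\<lambda>t. f t $ i) has_vector_derivative f' $ i) (at t)"
  shows "(f has_vector_derivative f') (at t)"
  using assms unfolding has_vector_derivative_def has_derivative_at_within
  by (auto intro!: vec_tendstoI bounded_linear_scaleR_left)

lemma has_vector_derivative_imp_quotient_tendsto:
  assumes "(f has_vector_derivative d) (at 0)"
  shows "((\<lambda>t. (f t - f 0) /\<^sub>R t) \<longlongrightarrow> d) (at 0)"
proof -
  have "((\<lambda>t. norm (f t - f 0 - t *\<^sub>R d) / norm t) \<longlongrightarrow> 0) (at 0)"
    using assms by (simp add: has_vector_derivative_def has_derivative_iff_norm)
  moreover have "norm (f t - f 0 - t *\<^sub>R d) / norm t = norm ((f t - f 0) /\<^sub>R t - d)" if "t \<noteq> 0" for t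
  proof -
    have "(f t - f 0) /\<^sub>R t - d = (f t - f 0 - t *\<^sub>R d) /\<^sub>R t"
      using that by (simp add: scaleR_diff_right)
    then show ?thesis
      by (simp add: divide_inverse mult.commute)
  qed
  then have "\<forall>\<^sub>F t in at 0. norm (f t - f 0 - t *\<^sub>R d) / norm t = norm ((f t - f 0) /\<^sub>R t - d)"
    by (simp add: eventually_at_filter)
  ultimately have "((\<lambda>t. norm ((f t - f 0) /\<^sub>R t - d)) \<longlongrightarrow> 0) (at 0)"
    by (rule Lim_transform_eventually)
  then show ?thesis
    by (simp add: tendsto_norm_zero_iff LIM_zero_iff)
qed

lemma cscale_of_real: "cscale (of_real t) A = t *\<^sub>R A"
  by (simp add: vec_eq_iff) (simp add: scaleR_conv_of_real)

lemma mexp_has_vector_derivative: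
  "((\<lambda>t. mexp (t *\<^sub>R A)) has_vector_derivative A ** mexp (t *\<^sub>R A)) (at t)"
  "((\<lambda>t. mexp (t *\<^sub>R A)) has_vector_derivative mexp (t *\<^sub>R A) ** A) (at t)"
  using has_vector_derivative_real_field[OF mexp_entry_has_field_derivative(1)[of A _ _ "of_real t"]]
    has_vector_derivative_real_field[OF mexp_entry_has_field_derivative(2)[of A _ _ "of_real t"]]
  by (auto intro!: has_vector_derivative_vec simp: cscale_of_real)

lemma mexp_0 [simp]: "mexp 0 = (mat 1 :: complex^'n^'n)"
proof -
  have "mexp (cscale 0 (0 :: complex^'n^'n)) $ i $ j = mat 1 $ i $ j" for i j
    using iffD1[OF powser_sums_zero_iff mexp_entry_sums[of "0 :: complex^'n^'n" i j]] by simp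
  moreover have "cscale 0 (0 :: complex^'n^'n) = 0"
    by (simp add: vec_eq_iff)
  ultimately show ?thesis
    by (intro vec_eq_iff[THEN iffD2] allI) simp
qed

text \<open>The left-hand side is constant in \<open>t\<close>: its derivative is
\<open>e\<^sup>(\<^sup>s\<^sup>+\<^sup>t\<^sup>)\<^sup>A A e\<^sup>-\<^sup>t\<^sup>A - e\<^sup>(\<^sup>s\<^sup>+\<^sup>t\<^sup>)\<^sup>A A e\<^sup>-\<^sup>t\<^sup>A = 0\<close>.\<close>

lemma mexp_add_scaleR_cancel: "mexp ((s + t) *\<^sub>R A) ** mexp (- t *\<^sub>R A) = mexp (s *\<^sub>R A)"
proof -
  let ?P = "\<lambda>t. mexp ((s + t) *\<^sub>R A) ** mexp (t *\<^sub>R (- A))"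
  have 1: "((\<lambda>t. mexp ((s + t) *\<^sub>R A)) has_vector_derivative mexp ((s + t) *\<^sub>R A) ** A) (at t)" for t
  proof -
    have "((\<lambda>t. s + t) has_vector_derivative 1) (at t)"
      by (auto intro!: derivative_eq_intros)
    from vector_diff_chain_at[OF this mexp_has_vector_derivative(2)] show ?thesis
      by (simp add: o_def)
  qed
  have "(?P has_vector_derivative 0) (at t)" for t
    using matrix_mult.has_vector_derivative[OF 1[of t] mexp_has_vector_derivative(1)[of "- A"]]
    by (simp add: matrix_mult.minus_left matrix_mult.minus_right matrix_mul_assoc del: scaleR_minus_right)
  then have "?P t = ?P 0"
    unfolding has_vector_derivative_def by (intro has_derivative_zero_unique[OF convex_UNIV]) simp_all
  then show ?thesis by simp
qed

lemma mexp_mult_minus: "mexp (t *\<^sub>R A) ** mexp (- t *\<^sub>R A) = mat 1"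
  using mexp_add_scaleR_cancel[of 0 t A] by simp

lemma mexp_add_scaleR: "mexp ((s + t) *\<^sub>R A) = mexp (s *\<^sub>R A) ** mexp (t *\<^sub>R A)"
  using mexp_add_scaleR_cancel[of "s + t" "- t" A] by simp

lemma invertible_mexp: "invertible (mexp A)"
  using mexp_mult_minus[of 1 A] mexp_mult_minus[of "-1" A] unfolding invertible_def by auto

section \<open>Polynomial and rational functions on matrices\<close>

lemma poly_in_sum:
  assumes "\<And>i. i \<in> I \<Longrightarrow> f i \<in> poly_in S"
  shows "(\<lambda>x. \<Sum>i\<in>I. f i x) \<in> poly_in S"
  using assms by (induction I rule: infinite_finite_induct) (auto intro: poly_in.intros)

lemma poly_in_prod:
  assumes "\<And>i. i \<in> I \<Longrightarrow> f i \<in> poly_in S"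
  shows "(\<lambda>x. \<Prod>i\<in>I. f i x) \<in> poly_in S"
  using assms by (induction I rule: infinite_finite_induct) (auto intro: poly_in.intros)

lemma entry_in_entry_functions: "(\<lambda>g. g $ i $ j) \<in> entry_functions"
  by (auto simp: entry_functions_def)

lemma det_poly: "det \<in> poly_in (entry_functions :: (complex^'n^'n \<Rightarrow> complex) set)"
proof -
  have "(\<lambda>A :: complex^'n^'n. \<Sum>p | p permutes UNIV. of_int (sign p) * (\<Prod>i\<in>UNIV. A $ i $ p i))
      \<in> poly_in entry_functions"
    by (intro poly_in_sum poly_in.mult poly_in.const poly_in_prod poly_in.gen entry_in_entry_functions)
  moreover have "det = (\<lambda>A :: complex^'n^'n. \<Sum>p | p permutes UNIV. of_int (sign p) * (\<Prod>i\<in>UNIV. A $ i $ p i))"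
    by (simp add: fun_eq_iff det_def)
  ultimately show ?thesis by simp
qed

lemma poly_in_entries_holomorphic:
  assumes "f \<in> poly_in entry_functions"
  shows "(\<lambda>z. f (mexp (cscale z A))) holomorphic_on UNIV"
  using assms
proof induction
  case (gen f)
  then obtain i j where "f = (\<lambda>g. g $ i $ j)"
    by (auto simp: entry_functions_def)
  then show ?case
    using mexp_entry_has_field_derivative(1)[of A i j] by (auto simp: holomorphic_on_open)
qed (auto intro!: holomorphic_intros)

lemma poly_in_entries_continuous:
  assumes "f \<in> poly_in entry_functions"
  shows "continuous_on UNIV f"
  using assms
  by induction (auto simp: entry_functions_def intro!: continuous_intros)

text \<open>A real derivative is complex linear as soon as it commutes with multiplication by \<open>\<i>\<close>; this
property is inherited by sums and products through the Leibniz rule.\<close>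

lemma poly_in_has_complex_derivative:
  assumes "f \<in> poly_in S"
    and "\<And>f. f \<in> S \<Longrightarrow> \<exists>D. (f has_derivative D) (at g) \<and> (\<forall>X. D (cscale \<i> X) = \<i> * D X)"
  shows "\<exists>D. (f has_derivative D) (at g) \<and> (\<forall>X. D (cscale \<i> X) = \<i> * D X)"
  using assms(1)
proof induction
  case (gen f)
  then show ?case by (rule assms(2))
next
  case (const c)
  then show ?case by (intro exI[of _ "\<lambda>_. 0"]) auto
next
  case (add f1 f2)
  then obtain D1 D2 where
    "(f1 has_derivative D1) (at g)" "\<forall>X. D1 (cscale \<i> X) = \<i> * D1 X"
    "(f2 has_derivative D2) (at g)" "\<forall>X. D2 (cscale \<i> X) = \<i> * D2 X"
    by blast
  then show ?case
    by (intro exI[of _ "\<lambda>X. D1 X + D2 X"]) (auto intro!: derivative_intros simp: distrib_left)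
next
  case (mult f1 f2)
  then obtain D1 D2 where
    "(f1 has_derivative D1) (at g)" "\<forall>X. D1 (cscale \<i> X) = \<i> * D1 X"
    "(f2 has_derivative D2) (at g)" "\<forall>X. D2 (cscale \<i> X) = \<i> * D2 X"
    by blast
  then show ?case
    by (intro exI[of _ "\<lambda>X. f1 g * D2 X + D1 X * f2 g"])
      (auto intro!: derivative_intros simp: distrib_left mult.left_commute mult.assoc)
qed

lemma entry_has_complex_derivative:
  assumes "f \<in> entry_functions"
  shows "\<exists>D. (f has_derivative D) (at g) \<and> (\<forall>X. D (cscale \<i> X) = \<i> * D X)"
proof -
  from assms obtain i j where f: "f = (\<lambda>g. g $ i $ j)"
    by (auto simp: entry_functions_def)
  have "bounded_linear f"
    unfolding f by (intro bounded_linear_compose[OF bounded_linear_vec_nth bounded_linear_vec_nth])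
  then show ?thesis
    by (intro exI[of _ f]) (auto intro: bounded_linear_imp_has_derivative simp: f)
qed

abbreviation rational_functions :: "(complex^'n^'n \<Rightarrow> complex) set" where
  "rational_functions \<equiv> poly_in (insert (\<lambda>g. inverse (det g)) entry_functions)"

lemma rational_has_complex_derivative:
  fixes g :: "complex^'n^'n"
  assumes "f \<in> rational_functions" and "invertible g"
  shows "\<exists>D. (f has_derivative D) (at g) \<and> (\<forall>X. D (cscale \<i> X) = \<i> * D X)"
  using assms(1)
proof (rule poly_in_has_complex_derivative)
  fix h :: "complex^'n^'n \<Rightarrow> complex"
  assume h: "h \<in> insert (\<lambda>g. inverse (det g)) entry_functions"
  obtain D where D: "(det has_derivative D) (at g)" "\<forall>X. D (cscale \<i> X) = \<i> * D X"
    using poly_in_has_complex_derivative[OF det_poly entry_has_complex_derivative] by blast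
  have "det g \<noteq> 0"
    using assms(2) by (simp add: invertible_det_nz)
  then have "((\<lambda>g. inverse (det g)) has_derivative (\<lambda>X. - (inverse (det g) * D X * inverse (det g)))) (at g)"
    by (intro Deriv.has_derivative_inverse D(1))
  then have inv: "\<exists>D. ((\<lambda>g. inverse (det g)) has_derivative D) (at g) \<and> (\<forall>X. D (cscale \<i> X) = \<i> * D X)"
    using D(2) by (intro exI[of _ "\<lambda>X. - (inverse (det g) * D X * inverse (det g))"] conjI) auto
  show "\<exists>D. (h has_derivative D) (at g) \<and> (\<forall>X. D (cscale \<i> X) = \<i> * D X)"
    using h
  proof
    assume "h = (\<lambda>g. inverse (det g))"
    with inv show ?thesis by simp
  next
    assume "h \<in> entry_functions"
    then show ?thesis by (rule entry_has_complex_derivative)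
  qed
qed

lemma
  assumes "f \<in> rational_functions"
  shows rational_has_derivative_at_1: "(f has_derivative frechet_derivative f (at (mat 1))) (at (mat 1))"
    and frechet_derivative_cscale_i:
      "frechet_derivative f (at (mat 1)) (cscale \<i> X) = \<i> * frechet_derivative f (at (mat 1)) X"
proof -
  have "invertible (mat 1 :: complex^'n^'n)"
    by (simp add: invertible_def)
  then obtain D where D: "(f has_derivative D) (at (mat 1))" "\<forall>X. D (cscale \<i> X) = \<i> * D X"
    using rational_has_complex_derivative[OF assms] by blast
  then have "frechet_derivative f (at (mat 1)) = D"
    by (metis frechet_derivative_at)
  with D show "(f has_derivative frechet_derivative f (at (mat 1))) (at (mat 1))"
    "frechet_derivative f (at (mat 1)) (cscale \<i> X) = \<i> * frechet_derivative f (at (mat 1)) X"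
    by auto
qed

lemma rational_along_mexp_has_vector_derivative:
  assumes "f \<in> rational_functions"
  shows "((\<lambda>t. f (mexp (t *\<^sub>R X))) has_vector_derivative frechet_derivative f (at (mat 1)) X) (at 0)"
proof -
  let ?D = "frechet_derivative f (at (mat 1))"
  have D: "(f has_derivative ?D) (at (mexp (0 *\<^sub>R X)))"
    using rational_has_derivative_at_1[OF assms] by simp
  have "((\<lambda>t. mexp (t *\<^sub>R X)) has_derivative (\<lambda>t. t *\<^sub>R X)) (at 0)"
    using mexp_has_vector_derivative(2)[of X 0] by (simp add: has_vector_derivative_def)
  from has_derivative_compose[OF this D]
  show ?thesis
    by (simp add: has_vector_derivative_def linear_scale[OF has_derivative_linear[OF D]])
qed

section \<open>One-parameter subgroups and the Lie algebra\<close>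

text \<open>Each defining polynomial of \<open>G\<close>, evaluated at \<open>e\<^sup>z\<^sup>X\<close>, is an entire function of \<open>z\<close> vanishing on
the reals, so it vanishes identically by the identity theorem.\<close>

lemma mexp_cscale_in_zariski_closed:
  assumes "zariski_closed_GL G" and "\<And>t :: real. mexp (t *\<^sub>R X) \<in> G"
  shows "mexp (cscale z X) \<in> G"
proof -
  obtain P where P: "P \<subseteq> poly_in entry_functions" "G = {g. invertible g \<and> (\<forall>p\<in>P. p g = 0)}"
    using assms(1) unfolding zariski_closed_GL_def by blast
  have "p (mexp (cscale z X)) = 0" if "p \<in> P" for p
  proof (rule analytic_continuation[of "\<lambda>z. p (mexp (cscale z X))" UNIV "\<real>" 0])
    show "(\<lambda>z. p (mexp (cscale z X))) holomorphic_on UNIV"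
      using P(1) that by (intro poly_in_entries_holomorphic) blast
    show "(0 :: complex) islimpt \<real>"
      unfolding islimpt_approachable
    proof (intro allI impI)
      fix e :: real
      assume "e > 0"
      then show "\<exists>x'\<in>\<real>. x' \<noteq> (0 :: complex) \<and> dist x' 0 < e"
        by (intro bexI[of _ "of_real (e / 2)"]) (simp_all del: of_real_divide)
    qed
    show "p (mexp (cscale w X)) = 0" if "w \<in> \<real>" for w
      using that \<open>p \<in> P\<close> assms(2) P(2) by (auto elim!: Reals_cases simp: cscale_of_real)
  qed auto
  then show ?thesis
    using P(2) invertible_mexp by blast
qed

lemma zariski_closed_limit:
  assumes "zariski_closed_GL G" and "\<And>n :: nat. A n \<in> G" and "A \<longlonglongrightarrow> g" and "invertible g"
  shows "g \<in> G"
proof -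
  obtain P where P: "P \<subseteq> poly_in entry_functions" "G = {g. invertible g \<and> (\<forall>p\<in>P. p g = 0)}"
    using assms(1) unfolding zariski_closed_GL_def by blast
  have "p g = 0" if "p \<in> P" for p
  proof -
    have "isCont p g"
      using poly_in_entries_continuous P(1) that continuous_on_eq_continuous_at[OF open_UNIV] by blast
    then have "(\<lambda>n. p (A n)) \<longlonglongrightarrow> p g"
      using assms(3) by (rule isCont_tendsto_compose)
    moreover have "p (A n) = 0" for n
      using assms(2)[of n] that P(2) by blast
    ultimately show ?thesis
      by (simp add: LIMSEQ_const_iff)
  qed
  then show ?thesis
    using P(2) assms(4) by blast
qed

lemma conj_transpose_mult: "conj_transpose (A ** B) = conj_transpose B ** conj_transpose A"
  by (simp add: conj_transpose_def vec_eq_iff matrix_matrix_mult_def transpose_def mult.commute)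

lemma unitary_group_mult: "U \<in> unitary_group \<Longrightarrow> V \<in> unitary_group \<Longrightarrow> U ** V \<in> unitary_group"
  unfolding unitary_group_def
  by (simp add: conj_transpose_mult) (metis matrix_mul_assoc matrix_mul_lid)

lemma closed_unitary_group: "closed (unitary_group :: (complex^'n^'n) set)"
  unfolding unitary_group_def conj_transpose_def vec_eq_iff
  by (auto simp: matrix_matrix_mult_def transpose_def
      intro!: closed_Collect_all closed_Collect_eq continuous_intros)

lemma unitary_group_bounded: "bounded (unitary_group :: (complex^'n^'n) set)"
proof -
  have "norm U \<le> (\<Sum>i\<in>(UNIV :: 'n set). \<Sum>j\<in>(UNIV :: 'n set). 1)" if "U \<in> unitary_group" for U :: "complex^'n^'n"
  proof -
    have entry: "norm (U $ i $ j) \<le> 1" for i j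
    proof -
      have "(\<Sum>k\<in>UNIV. cnj (U $ k $ j) * U $ k $ j) = (conj_transpose U ** U) $ j $ j"
        by (simp add: conj_transpose_def matrix_matrix_mult_def transpose_def)
      also have "\<dots> = 1"
        using that by (simp add: unitary_group_def mat_def)
      finally have "complex_of_real (\<Sum>k\<in>UNIV. (norm (U $ k $ j))\<^sup>2) = 1"
        by (simp only: of_real_sum complex_norm_square mult.commute)
      then have "(\<Sum>k\<in>UNIV. (norm (U $ k $ j))\<^sup>2) = 1"
        using of_real_eq_1_iff by blast
      moreover have "(norm (U $ i $ j))\<^sup>2 \<le> (\<Sum>k\<in>UNIV. (norm (U $ k $ j))\<^sup>2)"
        by (rule member_le_sum) auto
      ultimately show ?thesis
        by (simp add: power_le_one_iff)
    qed
    have "norm U \<le> (\<Sum>i\<in>UNIV. norm (U $ i))"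
      unfolding norm_vec_def by (rule L2_set_le_sum) simp
    also have "\<dots> \<le> (\<Sum>i\<in>UNIV. \<Sum>j\<in>UNIV. norm (U $ i $ j))"
      unfolding norm_vec_def[of "U $ _"] by (intro sum_mono L2_set_le_sum) simp
    also have "\<dots> \<le> (\<Sum>i\<in>(UNIV :: 'n set). \<Sum>j\<in>(UNIV :: 'n set). 1)"
      by (intro sum_mono entry)
    finally show ?thesis .
  qed
  then show ?thesis
    by (auto simp: bounded_iff)
qed

lemma matrix_power_mexp: "matrix_power (mexp (h *\<^sub>R Z)) k = mexp ((real k * h) *\<^sub>R Z)"
  by (induction k) (simp_all add: mexp_add_scaleR distrib_right)

text \<open>The telescoping estimate for \<open>A\<^sup>k - B\<^sup>k\<close>. It is stated with a left factor \<open>U \<in> K\<close> so that the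
induction can absorb one factor \<open>A\<close> into \<open>U\<close>; in this way the powers of \<open>A\<close> are controlled by the bound
\<open>R\<close> on \<open>K\<close>, and the estimate grows only linearly in \<open>k\<close>.\<close>

lemma norm_matrix_power_diff_le:
  fixes K :: "(complex^'n^'n) set"
  assumes K: "\<And>U V. U \<in> K \<Longrightarrow> V \<in> K \<Longrightarrow> U ** V \<in> K" "\<And>U. U \<in> K \<Longrightarrow> norm U \<le> R"
    and A: "A \<in> K"
    and c: "\<And>(X :: complex^'n^'n) (Y :: complex^'n^'n). norm (X ** Y) \<le> norm X * norm Y * c" "0 \<le> c"
    and M: "\<And>j. j < k \<Longrightarrow> norm (matrix_power B j) \<le> M"
    and U: "U \<in> K"
  shows "norm (U ** matrix_power A k - U ** matrix_power B k) \<le> real k * (R * c * M * c * norm (A - B))"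
  using U M
proof (induction k arbitrary: U)
  case (Suc k)
  have "U ** matrix_power A (Suc k) - U ** matrix_power B (Suc k) =
      ((U ** A) ** matrix_power A k - (U ** A) ** matrix_power B k)
      + U ** (A - B) ** matrix_power B k"
    by (simp add: matrix_mult.diff_left matrix_mult.diff_right matrix_mul_assoc)
  moreover have "norm ((U ** A) ** matrix_power A k - (U ** A) ** matrix_power B k)
      \<le> real k * (R * c * M * c * norm (A - B))"
    using Suc.prems by (intro Suc.IH K(1) A) auto
  moreover have "norm (U ** (A - B) ** matrix_power B k) \<le> R * c * M * c * norm (A - B)"
  proof -
    have "norm (U ** (A - B) ** matrix_power B k) \<le> (norm U * norm (A - B) * c) * norm (matrix_power B k) * c"
      using c(2) by (intro order_trans[OF c(1)] mult_right_mono c(1)) auto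
    also have "\<dots> \<le> (R * norm (A - B) * c) * M * c"
      using c(2) K(2)[OF Suc.prems(1)] Suc.prems(2)[of k] order_trans[OF norm_ge_zero K(2)[OF Suc.prems(1)]]
      by (intro mult_right_mono mult_mono) auto
    finally show ?thesis by (simp add: mult_ac)
  qed
  ultimately show ?case
    by (simp add: distrib_right) (smt (verit) norm_triangle_ineq)
qed simp

text \<open>The Lie product formula for an arbitrary curve in a bounded matrix monoid: \<open>\<gamma>(h)\<close> and \<open>e\<^sup>h\<^sup>Z\<close> agree to
first order at \<open>0\<close>, so for \<open>h = s/n\<close> their \<open>n\<close>-th powers differ by
\<open>O(n \<parallel>\<gamma>(h) - e\<^sup>h\<^sup>Z\<parallel>) = O(n o(1/n))\<close>.\<close>

lemma curve_power_tendsto_mexp: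
  fixes K :: "(complex^'n^'n) set"
  assumes K: "\<And>U V. U \<in> K \<Longrightarrow> V \<in> K \<Longrightarrow> U ** V \<in> K" "mat 1 \<in> K" "bounded K"
    and \<gamma>: "\<And>t :: real. \<gamma> t \<in> K" "\<gamma> 0 = mat 1" "(\<gamma> has_vector_derivative Z) (at 0)"
  shows "(\<lambda>n. matrix_power (\<gamma> (s / real (Suc n))) (Suc n)) \<longlonglongrightarrow> mexp (s *\<^sub>R Z)"
proof (cases "s = 0")
  case True
  have "matrix_power (mat 1 :: complex^'n^'n) k = mat 1" for k
    by (induction k) simp_all
  then show ?thesis
    using True \<gamma>(2) by simp
next
  case False
  obtain R where R: "\<And>U. U \<in> K \<Longrightarrow> norm U \<le> R"
    using K(3) by (auto simp: bounded_iff)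
  obtain c where c: "c > 0" "\<And>(X :: complex^'n^'n) (Y :: complex^'n^'n). norm (X ** Y) \<le> norm X * norm Y * c"
    using matrix_mult.pos_bounded by blast
  have "continuous_on {- \<bar>s\<bar>..\<bar>s\<bar>} (\<lambda>t. mexp (t *\<^sub>R Z))"
    using mexp_has_vector_derivative(1)[of Z]
    by (meson continuous_at_imp_continuous_on has_vector_derivative_continuous)
  then have "bounded ((\<lambda>t. mexp (t *\<^sub>R Z)) ` {- \<bar>s\<bar>..\<bar>s\<bar>})"
    by (intro compact_imp_bounded compact_continuous_image) auto
  then obtain M where "\<forall>t\<in>{- \<bar>s\<bar>..\<bar>s\<bar>}. norm (mexp (t *\<^sub>R Z)) \<le> M"
    unfolding bounded_iff by auto
  then have M: "norm (mexp (t *\<^sub>R Z)) \<le> M" if "\<bar>t\<bar> \<le> \<bar>s\<bar>" for t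
    using that by (simp add: abs_le_iff minus_le_iff)
  define \<delta> where "\<delta> h = \<gamma> h - mexp (h *\<^sub>R Z)" for h
  let ?h = "\<lambda>n. s / real (Suc n)"
  let ?C = "R * c * M * c"
  have "(\<delta> has_vector_derivative Z - Z) (at 0)"
    unfolding \<delta>_def using mexp_has_vector_derivative(2)[of Z 0]
    by (intro derivative_intros \<gamma>(3)) simp
  then have "(\<lambda>h. norm (\<delta> h) / \<bar>h\<bar>) \<midarrow>0\<rightarrow> 0"
    using \<gamma>(2) by (simp add: has_vector_derivative_def has_derivative_iff_norm \<delta>_def)
  moreover have "filterlim ?h (at 0) sequentially"
    using False LIMSEQ_Suc[OF lim_const_over_n[of s]] by (simp add: filterlim_at)
  ultimately have "(\<lambda>n. norm (\<delta> (?h n)) / \<bar>?h n\<bar>) \<longlonglongrightarrow> 0"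
    by (rule filterlim_compose)
  then have lim: "(\<lambda>n. ?C * \<bar>s\<bar> * (norm (\<delta> (?h n)) / \<bar>?h n\<bar>)) \<longlonglongrightarrow> 0"
    by (rule tendsto_mult_right_zero)
  have bound: "norm (matrix_power (\<gamma> (?h n)) (Suc n) - mexp (s *\<^sub>R Z))
      \<le> ?C * \<bar>s\<bar> * (norm (\<delta> (?h n)) / \<bar>?h n\<bar>)" for n
  proof -
    have "norm (mat 1 ** matrix_power (\<gamma> (?h n)) (Suc n) - mat 1 ** matrix_power (mexp (?h n *\<^sub>R Z)) (Suc n))
        \<le> real (Suc n) * (R * c * M * c * norm (\<gamma> (?h n) - mexp (?h n *\<^sub>R Z)))"
    proof (rule norm_matrix_power_diff_le[OF K(1) R \<gamma>(1) c(2) _ _ K(2)])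
      show "norm (matrix_power (mexp (?h n *\<^sub>R Z)) j) \<le> M" if "j < Suc n" for j
      proof -
        have "\<bar>real j * ?h n\<bar> \<le> \<bar>s\<bar>"
          using that mult_left_mono[of "real j" "1 + real n" "\<bar>s\<bar>"] by (simp add: abs_mult field_simps)
        then show ?thesis
          unfolding matrix_power_mexp by (rule M)
      qed
    qed (use c(1) in auto)
    also have "real (Suc n) * (R * c * M * c * norm (\<gamma> (?h n) - mexp (?h n *\<^sub>R Z)))
        = ?C * \<bar>s\<bar> * (norm (\<delta> (?h n)) / \<bar>?h n\<bar>)"
      using False by (simp add: \<delta>_def)
    finally show ?thesis
      using False by (simp only: matrix_power_mexp matrix_mul_lid) simp
  qed
  have "(\<lambda>n. matrix_power (\<gamma> (?h n)) (Suc n) - mexp (s *\<^sub>R Z)) \<longlonglongrightarrow> 0"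
    by (rule Lim_null_comparison[OF _ lim]) (intro always_eventually allI bound)
  then show ?thesis
    by (rule LIM_zero_cancel)
qed

lemma Lie_alg_scaleR:
  assumes "X \<in> Lie_alg K"
  shows "c *\<^sub>R X \<in> Lie_alg K"
  using assms by (auto simp: Lie_alg_def) 

text \<open>The curve \<open>e\<^sup>t\<^sup>X e\<^sup>t\<^sup>Y\<close> in \<open>K\<close> has velocity \<open>X + Y\<close> at \<open>0\<close>, so every \<open>e\<^sup>s\<^sup>(\<^sup>X\<^sup>+\<^sup>Y\<^sup>)\<close> is a limit of elements of
\<open>K\<close>. Limits of \<open>G\<close> could a priori leave \<open>GL(n)\<close>, but exponentials are invertible.\<close>

lemma Lie_alg_add:
  assumes G: "symmetric_subgroup G"
    and X: "X \<in> Lie_alg (G \<inter> unitary_group)" and Y: "Y \<in> Lie_alg (G \<inter> unitary_group)"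
  shows "X + Y \<in> Lie_alg (G \<inter> unitary_group)"
proof -
  let ?K = "G \<inter> unitary_group"
  define \<gamma> where "\<gamma> t = mexp (t *\<^sub>R X) ** mexp (t *\<^sub>R Y)" for t :: real
  have mult: "U ** V \<in> ?K" if "U \<in> ?K" "V \<in> ?K" for U V
    using that G unitary_group_mult by (auto simp: symmetric_subgroup_def)
  have \<gamma>: "\<gamma> t \<in> ?K" for t
    using X Y mult by (auto simp: \<gamma>_def Lie_alg_def)
  have one: "mat 1 \<in> ?K"
    using \<gamma>[of 0] by (simp add: \<gamma>_def)
  have "(\<gamma> has_vector_derivative X + Y) (at 0)"
    using matrix_mult.has_vector_derivative[OF mexp_has_vector_derivative(2)[of X 0] mexp_has_vector_derivative(2)[of Y 0]]
    unfolding \<gamma>_def by (simp add: add.commute)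
  then have lim: "(\<lambda>n. matrix_power (\<gamma> (s / real (Suc n))) (Suc n)) \<longlonglongrightarrow> mexp (s *\<^sub>R (X + Y))" for s
    using mult one \<gamma> unitary_group_bounded
    by (intro curve_power_tendsto_mexp[where K = ?K]) (auto intro: bounded_subset simp: \<gamma>_def[of 0])
  have mem: "matrix_power (\<gamma> t) k \<in> ?K" for t k
    by (induction k) (use one mult \<gamma> in auto)
  have "mexp (s *\<^sub>R (X + Y)) \<in> ?K" for s
  proof
    show "mexp (s *\<^sub>R (X + Y)) \<in> G"
      using G mem by (intro zariski_closed_limit[OF _ _ lim invertible_mexp]) (auto simp: symmetric_subgroup_def simp del: matrix_power_Suc)
    show "mexp (s *\<^sub>R (X + Y)) \<in> unitary_group"
      using mem by (intro closed_sequentially[OF closed_unitary_group _ lim]) blast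
  qed
  then show ?thesis
    by (simp add: Lie_alg_def)
qed

lemma subspace_iLie:
  fixes G :: "(complex^'n^'n) set"
  assumes "symmetric_subgroup G"
  shows "subspace (iLie (G \<inter> unitary_group))"
proof -
  have "conj_transpose (mat 1 :: complex^'n^'n) = mat 1"
    by (simp add: conj_transpose_def transpose_mat) (simp add: vec_eq_iff mat_def)
  then have "mat 1 \<in> G \<inter> unitary_group"
    using assms by (auto simp: symmetric_subgroup_def unitary_group_def)
  have 0: "0 \<in> Lie_alg (G \<inter> unitary_group)"
    using \<open>mat 1 \<in> _\<close> by (simp add: Lie_alg_def)
  then have "subspace (Lie_alg (G \<inter> unitary_group))"
    using assms by (auto simp: subspace_def intro: Lie_alg_add Lie_alg_scaleR)
  moreover have "linear (cscale \<i>)"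
    by (auto intro!: linearI simp: vec_eq_iff algebra_simps)
  ultimately show ?thesis
    unfolding iLie_def by (rule linear_subspace_image[rotated])
qed

lemma iLieE:
  assumes "H \<in> iLie K"
  obtains X where "X \<in> Lie_alg K" "H = cscale \<i> X"
  using assms by (auto simp: iLie_def)

lemma mexp_iLie_in_group:
  assumes "symmetric_subgroup G" and "H \<in> iLie (G \<inter> unitary_group)"
  shows "mexp (t *\<^sub>R H) \<in> G"
proof -
  obtain X where X: "X \<in> Lie_alg (G \<inter> unitary_group)" "H = cscale \<i> X"
    using assms(2) by (rule iLieE)
  have "t *\<^sub>R H = cscale (of_real t * \<i>) X"
    unfolding X(2) cscale_of_real[symmetric] by (simp add: vec_eq_iff)
  moreover have "mexp (cscale (of_real t * \<i>) X) \<in> G"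
    using assms(1) X(1) by (intro mexp_cscale_in_zariski_closed) (auto simp: symmetric_subgroup_def Lie_alg_def)
  ultimately show ?thesis by simp
qed

section \<open>Hermitian spaces\<close>

context hermitian_space
begin

lemma ip_add_left: "ip (x + y) z = ip x z + ip y z"
  using ip_commute[of "x + y" z] ip_commute[of x z] ip_commute[of y z] by (simp add: ip_add_right)

lemma ip_scale_left: "ip (smul c x) y = cnj c * ip x y"
  using ip_commute[of "smul c x" y] ip_commute[of x y] by (simp add: ip_scale_right)

lemma ip_zero_right [simp]: "ip x 0 = 0"
  using ip_add_right[of x 0 0] by simp

lemma ip_zero_left [simp]: "ip 0 x = 0"
  using ip_add_left[of 0 0 x] by simp

lemma ip_diff_right: "ip x (y - z) = ip x y - ip x z"
  using ip_add_right[of x "y - z" z] by simp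

lemma ip_diff_left: "ip (x - y) z = ip x z - ip y z"
  using ip_add_left[of "x - y" y z] by simp

lemma ip_sum_right: "ip x (\<Sum>i\<in>I. f i) = (\<Sum>i\<in>I. ip x (f i))"
  by (induction I rule: infinite_finite_induct) (simp_all add: ip_add_right)

lemma ip_self: "ip x x = of_real ((hnorm ip x)\<^sup>2)"
proof -
  have "Re (ip x x) \<ge> 0"
    using ip_pos[of x] by (cases "x = 0") auto
  moreover have "Im (ip x x) = 0"
    using ip_commute[of x x] by (metis complex_cnj_cancel_iff complex_eq_iff cnj.simps(2) neg_equal_zero)
  ultimately show ?thesis
    by (simp add: hnorm_def complex_eq_iff)
qed

lemma hnorm_pos: "x \<noteq> 0 \<Longrightarrow> hnorm ip x > 0"
  using ip_pos by (simp add: hnorm_def)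

lemma hnorm_nonneg: "hnorm ip x \<ge> 0"
  using hnorm_pos[of x] by (cases "x = 0") (auto simp: hnorm_def)

lemma hnorm_zero [simp]: "hnorm ip 0 = 0"
  by (simp add: hnorm_def)

lemma hnorm_scale: "hnorm ip (smul c x) = norm c * hnorm ip x"
proof -
  have "ip (smul c x) (smul c x) = of_real ((norm c)\<^sup>2) * ip x x"
    by (simp add: ip_scale_left ip_scale_right complex_norm_square mult_ac del: of_real_power)
  then have "hnorm ip (smul c x) = sqrt ((norm c)\<^sup>2 * Re (ip x x))"
    by (simp add: hnorm_def del: of_real_power)
  then show ?thesis
    by (simp add: real_sqrt_mult hnorm_def)
qed

lemma ip_eqI:
  assumes "\<And>a. ip a x = ip a y"
  shows "x = y"
proof (rule ccontr)
  assume "x \<noteq> y"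
  then have "0 < Re (ip (x - y) (x - y))"
    by (intro ip_pos) simp
  with assms show False
    by (simp add: ip_diff_right)
qed

text \<open>Gram-Schmidt. The spanning property is stated as the expansion of the given vectors, the form in
which it extends to the whole space by linearity.\<close>

lemma exists_orthonormal_set:
  assumes "finite S"
  shows "\<exists>T. finite T \<and> (\<forall>s\<in>T. \<forall>t\<in>T. ip s t = (if s = t then 1 else 0)) \<and>
    (\<forall>x\<in>S. x = (\<Sum>t\<in>T. smul (ip t x) t))"
  using assms
proof induction
  case empty
  then show ?case by (intro exI[of _ "{}"]) simp
next
  case (insert a S)
  then obtain T where T: "finite T" "\<And>s t. s \<in> T \<Longrightarrow> t \<in> T \<Longrightarrow> ip s t = (if s = t then 1 else 0)"
    "\<And>x. x \<in> S \<Longrightarrow> x = (\<Sum>t\<in>T. smul (ip t x) t)"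
    by blast
  define a' where "a' = a - (\<Sum>t\<in>T. smul (ip t a) t)"
  have orth: "ip t a' = 0" if "t \<in> T" for t
  proof -
    have "ip t (\<Sum>t\<in>T. smul (ip t a) t) = (\<Sum>s\<in>T. if t = s then ip s a else 0)"
      using T(2)[OF that] by (auto simp: ip_sum_right ip_scale_right intro: sum.cong)
    then show ?thesis
      using T(1) that by (simp add: a'_def ip_diff_right sum.delta)
  qed
  show ?case
  proof (cases "a' = 0")
    case True
    then show ?thesis
      using T by (intro exI[of _ T]) (auto simp: a'_def)
  next
    case False
    define e where "e = smul (inverse (of_real (hnorm ip a'))) a'"
    have ee: "ip e e = 1"
      using hnorm_pos[OF False] by (simp add: ip_self e_def hnorm_scale norm_inverse)
    have te: "ip t e = 0" if "t \<in> T" for t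
      using orth[OF that] by (simp add: e_def ip_scale_right)
    have et: "ip e t = 0" if "t \<in> T" for t
      using te[OF that] ip_commute[of e t] by simp
    have "e \<notin> T"
      using te ee by fastforce
    have eS: "ip e x = 0" if "x \<in> S" for x
    proof -
      have "ip e x = ip e (\<Sum>t\<in>T. smul (ip t x) t)"
        using T(3)[OF that] by simp
      then show ?thesis
        by (simp add: ip_sum_right ip_scale_right et)
    qed
    have a: "a = a' + (\<Sum>t\<in>T. smul (ip t a) t)"
      by (simp add: a'_def)
    have "ip e a = ip e a'"
      by (subst a) (simp add: ip_add_right ip_sum_right ip_scale_right et)
    also have "\<dots> = of_real (hnorm ip a')"
      using hnorm_pos[OF False] by (simp add: e_def ip_scale_left ip_self power2_eq_square)
    finally have "smul (ip e a) e = a'"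
      using hnorm_pos[OF False] by (simp add: e_def)
    then have "a = (\<Sum>t\<in>insert e T. smul (ip t a) t)"
      using a T(1) \<open>e \<notin> T\<close> by simp
    moreover have "x = (\<Sum>t\<in>insert e T. smul (ip t x) t)" if "x \<in> S" for x
      using T(3)[OF that] T(1) \<open>e \<notin> T\<close> by (simp add: eS[OF that])
    ultimately show ?thesis
      using T(1,2) ee te et \<open>e \<notin> T\<close> by (intro exI[of _ "insert e T"]) auto
  qed
qed

text \<open>A finite set in which every vector has the expansion \<open>x = \<Sum> \<langle>t, x\<rangle> t\<close>. Orthonormal bases have it,
and this property alone yields Parseval's identity and the norm estimates below.\<close>

definition parseval_frame :: "'v set" where
  "parseval_frame = (SOME T. finite T \<and> (\<forall>x. x = (\<Sum>t\<in>T. smul (ip t x) t)))"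

lemma finite_frame: "finite parseval_frame"
  and frame_expansion: "(\<Sum>t\<in>parseval_frame. smul (ip t x) t) = x"
proof -
  obtain T where T: "finite T" "\<And>b. b \<in> Basis \<Longrightarrow> b = (\<Sum>t\<in>T. smul (ip t b) t)"
    using exists_orthonormal_set[OF finite_Basis] by blast
  have "x = (\<Sum>t\<in>T. smul (ip t x) t)" for x
  proof -
    have "x \<in> span Basis"
      by (simp add: span_Basis)
    then show ?thesis
    proof (induction rule: span_induct_alt)
      case (step c b y)
      have "smul c b = (\<Sum>t\<in>T. smul (c * ip t b) t)"
        using arg_cong[OF T(2)[OF step(1)], of "smul c"] by (simp add: scale_sum_right)
      moreover have "(\<Sum>t\<in>T. smul (ip t (smul c b + y)) t)
          = (\<Sum>t\<in>T. smul (c * ip t b) t) + (\<Sum>t\<in>T. smul (ip t y) t)"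
        by (simp add: ip_add_right ip_scale_right scale_left_distrib sum.distrib)
      ultimately show ?case
        using step(2) by metis
    qed simp
  qed
  with T(1) have "\<exists>T. finite T \<and> (\<forall>x. x = (\<Sum>t\<in>T. smul (ip t x) t))"
    by blast
  then have "finite parseval_frame \<and> (\<forall>x. x = (\<Sum>t\<in>parseval_frame. smul (ip t x) t))"
    unfolding parseval_frame_def by (rule someI_ex)
  then show "finite parseval_frame" "(\<Sum>t\<in>parseval_frame. smul (ip t x) t) = x"
    by auto
qed

lemma ip_frame_right: "ip x y = (\<Sum>t\<in>parseval_frame. ip t y * ip x t)"
  using arg_cong[OF frame_expansion[of y], of "ip x"] by (simp add: ip_sum_right ip_scale_right)

lemma ip_frame: "ip x y = (\<Sum>t\<in>parseval_frame. cnj (ip t x) * ip t y)"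
  unfolding ip_frame_right[of x y]
  by (intro sum.cong) (simp_all add: ip_commute[of x] mult.commute)

lemma hnorm_frame: "hnorm ip x = L2_set (\<lambda>t. norm (ip t x)) parseval_frame"
  unfolding hnorm_def L2_set_def ip_frame[of x x]
  by (intro arg_cong[where f = sqrt])
    (simp add: Re_sum cmod_power2, simp add: power2_eq_square)

lemma hnorm_le_sum: "hnorm ip x \<le> (\<Sum>t\<in>parseval_frame. norm (ip t x))"
  unfolding hnorm_frame by (rule L2_set_le_sum) simp

lemma norm_ip_frame_le: "t \<in> parseval_frame \<Longrightarrow> norm (ip t x) \<le> hnorm ip x"
  unfolding hnorm_frame by (rule member_le_L2_set[OF finite_frame])

lemma hnorm_linear_le:
  assumes "Vector_Spaces.linear smul smul L"
  shows "hnorm ip (L x) \<le> (\<Sum>t\<in>parseval_frame. \<Sum>s\<in>parseval_frame. norm (ip t (L s))) * hnorm ip x"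
proof -
  interpret L: Vector_Spaces.linear smul smul L by fact
  have "norm (ip t (L x)) \<le> (\<Sum>s\<in>parseval_frame. norm (ip t (L s))) * hnorm ip x" for t
  proof -
    have "L x = (\<Sum>s\<in>parseval_frame. smul (ip s x) (L s))"
      using arg_cong[OF frame_expansion[of x], of L] by (simp add: L.sum L.scale)
    then have "norm (ip t (L x)) \<le> (\<Sum>s\<in>parseval_frame. norm (ip s x * ip t (L s)))"
      by (simp add: ip_sum_right ip_scale_right norm_sum)
    also have "\<dots> \<le> (\<Sum>s\<in>parseval_frame. hnorm ip x * norm (ip t (L s)))"
      by (intro sum_mono) (auto simp: norm_mult intro!: mult_right_mono norm_ip_frame_le)
    finally show ?thesis
      by (simp add: sum_distrib_left mult.commute)
  qed
  then have "(\<Sum>t\<in>parseval_frame. norm (ip t (L x))) \<le> (\<Sum>t\<in>parseval_frame. (\<Sum>s\<in>parseval_frame. norm (ip t (L s))) * hnorm ip x)"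
    by (rule sum_mono)
  then show ?thesis
    using hnorm_le_sum[of "L x"] by (simp add: sum_distrib_right)
qed

lemma le_hop_norm:
  assumes "Vector_Spaces.linear smul smul L"
  shows "hnorm ip (L x) \<le> hop_norm ip L * hnorm ip x"
proof (cases "x = 0")
  case True
  interpret L: Vector_Spaces.linear smul smul L by fact
  show ?thesis using True by (simp add: L.zero)
next
  case False
  have "hnorm ip (L y) / hnorm ip y \<le> (\<Sum>t\<in>parseval_frame. \<Sum>s\<in>parseval_frame. norm (ip t (L s)))" for y
    using hnorm_linear_le[OF assms, of y] hnorm_nonneg[of y]
    by (cases "hnorm ip y = 0") (auto simp: field_simps intro!: sum_nonneg)
  then have "hnorm ip (L x) / hnorm ip x \<le> hop_norm ip L"
    unfolding hop_norm_def by (intro cSUP_upper bdd_aboveI2) auto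
  then show ?thesis
    using hnorm_pos[OF False] by (simp add: field_simps)
qed

lemma hop_norm_le:
  assumes "\<And>x. hnorm ip (L x) \<le> C * hnorm ip x" "C \<ge> 0"
  shows "hop_norm ip L \<le> C"
  unfolding hop_norm_def
proof (rule cSUP_least)
  fix x
  show "hnorm ip (L x) / hnorm ip x \<le> C"
    using assms(1)[of x] assms(2) hnorm_nonneg[of x]
    by (cases "hnorm ip x = 0") (auto simp: field_simps)
qed simp

text \<open>Cauchy-Schwarz: the component of \<open>y\<close> orthogonal to \<open>u\<close> has squared norm
\<open>\<parallel>y\<parallel>\<^sup>2 - |\<langle>u, y\<rangle>|\<^sup>2 \<ge> 0\<close>.\<close>

lemma norm_ip_unit_le:
  assumes "hnorm ip u = 1"
  shows "norm (ip u y) \<le> hnorm ip y"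
proof -
  let ?c = "ip u y"
  have uu: "ip u u = 1" using assms by (simp add: ip_self)
  have yu: "ip y u = cnj ?c" by (rule ip_commute)
  have "ip (y - smul ?c u) (y - smul ?c u) = ip y y - ?c * cnj ?c"
    by (simp add: ip_diff_left ip_diff_right ip_scale_left ip_scale_right uu yu algebra_simps)
  then have "complex_of_real ((hnorm ip (y - smul ?c u))\<^sup>2) = of_real ((hnorm ip y)\<^sup>2 - (norm ?c)\<^sup>2)"
    unfolding ip_self of_real_diff complex_norm_square .
  then have "(hnorm ip (y - smul ?c u))\<^sup>2 = (hnorm ip y)\<^sup>2 - (norm ?c)\<^sup>2"
    using of_real_eq_iff by blast
  then have "(norm ?c)\<^sup>2 \<le> (hnorm ip y)\<^sup>2"
    by (smt (verit) zero_le_power2)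
  then show ?thesis
    using hnorm_nonneg by (rule power2_le_imp_le)
qed

text \<open>The weak derivative of a curve; in finite dimension it is the derivative in norm.\<close>

definition has_curve_derivative :: "(real \<Rightarrow> 'v) \<Rightarrow> 'v \<Rightarrow> real \<Rightarrow> bool" where
  "has_curve_derivative x x' t \<longleftrightarrow> (\<forall>a. ((\<lambda>s. ip a (x s)) has_vector_derivative ip a x') (at t))"

lemma has_curve_derivative_unique:
  "has_curve_derivative x x' t \<Longrightarrow> has_curve_derivative x x'' t \<Longrightarrow> x' = x''"
  unfolding has_curve_derivative_def by (intro ip_eqI) (metis vector_derivative_at)

lemma has_curve_derivative_add:
  "has_curve_derivative x x' t \<Longrightarrow> has_curve_derivative y y' t \<Longrightarrow>
    has_curve_derivative (\<lambda>s. x s + y s) (x' + y') t"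
  unfolding has_curve_derivative_def ip_add_right by (auto intro: has_vector_derivative_add)

lemma has_curve_derivative_scale:
  "has_curve_derivative x x' t \<Longrightarrow> has_curve_derivative (\<lambda>s. smul c (x s)) (smul c x') t"
  unfolding has_curve_derivative_def ip_scale_right by (auto intro: has_vector_derivative_mult_right)

text \<open>The product rule holds although both curves are only weakly differentiable, because Parseval's
identity writes the inner product as a finite sum of products of coordinates.\<close>

lemma has_curve_derivative_ip:
  assumes "has_curve_derivative x x' t" "has_curve_derivative y y' t"
  shows "((\<lambda>s. ip (x s) (y s)) has_vector_derivative ip x' (y t) + ip (x t) y') (at t)"
proof -
  have "((\<lambda>s. \<Sum>b\<in>parseval_frame. cnj (ip b (x s)) * ip b (y s)) has_vector_derivative
      (\<Sum>b\<in>parseval_frame. cnj (ip b (x t)) * ip b y' + cnj (ip b x') * ip b (y t))) (at t)"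
    using assms unfolding has_curve_derivative_def
    by (intro has_vector_derivative_sum has_vector_derivative_mult has_vector_derivative_cnj) auto
  then show ?thesis
    by (simp add: ip_frame[symmetric] sum.distrib add.commute)
qed

end

section \<open>The derivative of a rational representation\<close>

text \<open>Only the restriction of \<open>\<pi>\<close> to \<open>K\<close> is unitary.\<close>

locale unitary_representation = hermitian_space smul Basis ip
  for smul :: "complex \<Rightarrow> 'v::ab_group_add \<Rightarrow> 'v" and Basis and ip +
  fixes G :: "(complex^'n^'n) set" and \<pi> :: "complex^'n^'n \<Rightarrow> 'v \<Rightarrow> 'v"
  assumes symmetric: "symmetric_subgroup G"
    and rational: "rational_representation smul Basis G \<pi>"
    and invariant: "k \<in> G \<inter> unitary_group \<Longrightarrow> ip (\<pi> k x) (\<pi> k y) = ip x y"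
begin

abbreviation "K \<equiv> G \<inter> unitary_group"

lemma one_in_G: "mat 1 \<in> G"
  using symmetric by (simp add: symmetric_subgroup_def)

lemma mult_in_G: "g \<in> G \<Longrightarrow> h \<in> G \<Longrightarrow> g ** h \<in> G"
  using symmetric by (simp add: symmetric_subgroup_def)

lemma linear_rep: "g \<in> G \<Longrightarrow> Vector_Spaces.linear smul smul (\<pi> g)"
  and bij_rep: "g \<in> G \<Longrightarrow> bij (\<pi> g)"
  and rep_mult: "g \<in> G \<Longrightarrow> h \<in> G \<Longrightarrow> \<pi> (g ** h) x = \<pi> g (\<pi> h x)"
  using rational unfolding rational_representation_def by (auto simp: o_def)

lemma rep_add: "g \<in> G \<Longrightarrow> \<pi> g (x + y) = \<pi> g x + \<pi> g y"
  and rep_scale: "g \<in> G \<Longrightarrow> \<pi> g (smul c x) = smul c (\<pi> g x)"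
proof -
  assume "g \<in> G"
  then interpret L: Vector_Spaces.linear smul smul "\<pi> g" by (rule linear_rep)
  show "\<pi> g (x + y) = \<pi> g x + \<pi> g y" "\<pi> g (smul c x) = smul c (\<pi> g x)"
    by (simp_all add: L.add L.scale)
qed

lemma rep_one: "\<pi> (mat 1) x = x"
proof -
  have "\<pi> (mat 1) (\<pi> (mat 1) x) = \<pi> (mat 1) x"
    using rep_mult[OF one_in_G one_in_G] by simp
  then show ?thesis
    using bij_rep[OF one_in_G] by (meson bij_is_inj injD)
qed

lemma rep_nonzero:
  assumes "g \<in> G" "x \<noteq> 0"
  shows "\<pi> g x \<noteq> 0"
proof
  interpret L: Vector_Spaces.linear smul smul "\<pi> g"
    using assms(1) by (rule linear_rep)
  assume "\<pi> g x = 0"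
  then have "\<pi> g x = \<pi> g 0"
    by (simp add: L.zero)
  with assms bij_rep show False
    by (metis bij_is_inj injD)
qed

text \<open>Expanding \<open>w\<close> and each \<open>\<pi>(g) b'\<close> in the given basis writes the coefficient as a combination, with
constants independent of \<open>g\<close>, of the matrix entries of \<open>\<pi>(g)\<close>.\<close>

lemma matrix_coefficient_rational:
  "\<exists>f\<in>rational_functions. \<forall>g\<in>G. ip a (\<pi> g w) = f g"
proof -
  let ?rep = "representation Basis"
  define F where "F b b' = (SOME f. f \<in> rational_functions \<and> (\<forall>g\<in>G. ?rep (\<pi> g b') b = f g))" for b b'
  have "F b b' \<in> rational_functions \<and> (\<forall>g\<in>G. ?rep (\<pi> g b') b = F b b' g)"
    if "b \<in> Basis" "b' \<in> Basis" for b b'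
  proof -
    have "\<exists>f. f \<in> rational_functions \<and> (\<forall>g\<in>G. ?rep (\<pi> g b') b = f g)"
      using rational that unfolding rational_representation_def Bex_def by simp
    then show ?thesis
      unfolding F_def by (rule someI_ex)
  qed
  then have F: "F b b' \<in> rational_functions" "g \<in> G \<Longrightarrow> ?rep (\<pi> g b') b = F b b' g"
    if "b \<in> Basis" "b' \<in> Basis" for b b' g
    using that by blast+
  have expand: "(\<Sum>b\<in>Basis. smul (?rep x b) b) = x" for x
    using independent_Basis span_Basis finite_Basis by (intro sum_representation_eq) auto
  have "ip a (\<pi> g w) = (\<Sum>b'\<in>Basis. ?rep w b' * (\<Sum>b\<in>Basis. F b b' g * ip a b))" if "g \<in> G" for g
  proof -
    interpret L: Vector_Spaces.linear smul smul "\<pi> g"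
      using that by (rule linear_rep)
    have inner: "ip a (\<pi> g b') = (\<Sum>b\<in>Basis. F b b' g * ip a b)" if "b' \<in> Basis" for b'
    proof -
      have "ip a (\<pi> g b') = ip a (\<Sum>b\<in>Basis. smul (?rep (\<pi> g b') b) b)"
        by (simp only: expand)
      also have "\<dots> = (\<Sum>b\<in>Basis. F b b' g * ip a b)"
        unfolding ip_sum_right ip_scale_right
        using that \<open>g \<in> G\<close> by (intro sum.cong refl) (simp only: F(2))
      finally show ?thesis .
    qed
    have "ip a (\<pi> g w) = ip a (\<pi> g (\<Sum>b'\<in>Basis. smul (?rep w b') b'))"
      by (simp only: expand)
    also have "\<dots> = (\<Sum>b'\<in>Basis. ?rep w b' * ip a (\<pi> g b'))"
      by (simp only: L.sum L.scale ip_sum_right ip_scale_right)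
    also have "\<dots> = (\<Sum>b'\<in>Basis. ?rep w b' * (\<Sum>b\<in>Basis. F b b' g * ip a b))"
      by (intro sum.cong refl) (simp only: inner)
    finally show ?thesis .
  qed
  moreover have "(\<lambda>g. \<Sum>b'\<in>Basis. ?rep w b' * (\<Sum>b\<in>Basis. F b b' g * ip a b)) \<in> rational_functions"
    by (intro poly_in_sum poly_in.mult poly_in.const F(1))
  ultimately show ?thesis
    by (intro bexI[rotated] ballI) assumption+
qed

text \<open>A choice of rational function agreeing with \<open>\<langle>a, \<pi>(g) w\<rangle>\<close> on \<open>G\<close>. Unlike the coefficient itself,
which carries information only on \<open>G\<close>, it is differentiable in every direction at the identity.\<close>

definition coefficient :: "'v \<Rightarrow> 'v \<Rightarrow> complex^'n^'n \<Rightarrow> complex" where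
  "coefficient a w = (SOME f. f \<in> rational_functions \<and> (\<forall>g\<in>G. ip a (\<pi> g w) = f g))"

lemma coefficient_rational: "coefficient a w \<in> rational_functions"
  and coefficient_eq: "g \<in> G \<Longrightarrow> coefficient a w g = ip a (\<pi> g w)"
proof -
  have "coefficient a w \<in> rational_functions \<and> (\<forall>g\<in>G. ip a (\<pi> g w) = coefficient a w g)"
    using matrix_coefficient_rational[of a w] unfolding coefficient_def Bex_def by (rule someI_ex)
  then show "coefficient a w \<in> rational_functions" "g \<in> G \<Longrightarrow> coefficient a w g = ip a (\<pi> g w)"
    by auto
qed

text \<open>The Lie algebra representation, extended linearly to all matrices through the rational functions
above. For directions \<open>X\<close> not tangent to \<open>G\<close> the value depends on the chosen extensions; linearity
in \<open>X\<close> is nevertheless unconditional, and for tangent directions \<open>lie_rep_eq\<close> identifies it with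
\<open>\<Pi>(X)\<close>.\<close>

definition drep :: "complex^'n^'n \<Rightarrow> 'v \<Rightarrow> 'v" where
  "drep X w = (\<Sum>t\<in>parseval_frame. smul (frechet_derivative (coefficient t w) (at (mat 1)) X) t)"

lemma
  shows bounded_linear_dcoefficient: "bounded_linear (frechet_derivative (coefficient a w) (at (mat 1)))"
    and drep_linear: "drep (X + Y) w = drep X w + drep Y w" "drep (c *\<^sub>R X) w = smul (of_real c) (drep X w)"
    and drep_cscale_i: "drep (cscale \<i> X) w = smul \<i> (drep X w)"
proof -
  show D: "bounded_linear (frechet_derivative (coefficient a w) (at (mat 1)))" for a
    using rational_has_derivative_at_1[OF coefficient_rational] by (rule has_derivative_bounded_linear)
  show "drep (X + Y) w = drep X w + drep Y w" "drep (c *\<^sub>R X) w = smul (of_real c) (drep X w)"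
    by (simp_all add: drep_def linear_add[OF bounded_linear.linear[OF D]] linear_scale[OF bounded_linear.linear[OF D]]
        scale_left_distrib sum.distrib scale_sum_right) (simp add: scaleR_conv_of_real)
  show "drep (cscale \<i> X) w = smul \<i> (drep X w)"
    by (simp add: drep_def frechet_derivative_cscale_i[OF coefficient_rational] scale_sum_right)
qed

lemma one_parameter_curve_derivative_0:
  assumes X: "\<And>t :: real. mexp (t *\<^sub>R X) \<in> G"
  shows "has_curve_derivative (\<lambda>t. \<pi> (mexp (t *\<^sub>R X)) w) (drep X w) 0"
  unfolding has_curve_derivative_def
proof
  fix a
  have "((\<lambda>t. \<Sum>b\<in>parseval_frame. coefficient b w (mexp (t *\<^sub>R X)) * ip a b) has_vector_derivative
      (\<Sum>b\<in>parseval_frame. frechet_derivative (coefficient b w) (at (mat 1)) X * ip a b)) (at 0)"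
    by (intro has_vector_derivative_sum has_vector_derivative_mult_left
        rational_along_mexp_has_vector_derivative coefficient_rational)
  then show "((\<lambda>t. ip a (\<pi> (mexp (t *\<^sub>R X)) w)) has_vector_derivative ip a (drep X w)) (at 0)"
    by (simp add: coefficient_eq[OF X] ip_frame_right[symmetric] drep_def ip_sum_right ip_scale_right)
qed

text \<open>By the group law the curve at time \<open>s\<close> is \<open>\<pi>(e\<^sup>(\<^sup>s\<^sup>-\<^sup>t\<^sup>)\<^sup>X)\<close> applied to its value at time \<open>t\<close>, which
reduces the claim to time \<open>0\<close>.\<close>

lemma one_parameter_curve_derivative:
  assumes X: "\<And>t :: real. mexp (t *\<^sub>R X) \<in> G"
  shows "has_curve_derivative (\<lambda>t. \<pi> (mexp (t *\<^sub>R X)) w) (drep X (\<pi> (mexp (t *\<^sub>R X)) w)) t"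
  unfolding has_curve_derivative_def
proof
  fix a
  let ?w = "\<pi> (mexp (t *\<^sub>R X)) w"
  let ?\<phi> = "\<lambda>s. ip a (\<pi> (mexp (s *\<^sub>R X)) ?w)"
  have shift: "((\<lambda>s. s - t) has_vector_derivative 1) (at t)"
    by (auto intro!: derivative_eq_intros)
  have "(?\<phi> has_vector_derivative ip a (drep X ?w)) (at (t - t))"
    using one_parameter_curve_derivative_0[OF X] by (simp add: has_curve_derivative_def)
  from vector_diff_chain_at[OF shift this]
  have "((\<lambda>s. ?\<phi> (s - t)) has_vector_derivative ip a (drep X ?w)) (at t)"
    by (simp add: o_def)
  moreover have "?\<phi> (s - t) = ip a (\<pi> (mexp (s *\<^sub>R X)) w)" for s
    using rep_mult[OF X X, of "s - t" t w] mexp_add_scaleR[of "s - t" t X] by simp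
  ultimately show "((\<lambda>s. ip a (\<pi> (mexp (s *\<^sub>R X)) w)) has_vector_derivative ip a (drep X ?w)) (at t)"
    by simp
qed

text \<open>Linearity in the vector, in contrast to linearity in \<open>X\<close>, is not visible from the chosen rational
functions; it comes from uniqueness of derivatives, as each \<open>\<pi>(e\<^sup>t\<^sup>X)\<close> is linear.\<close>

lemma linear_drep:
  assumes X: "\<And>t :: real. mexp (t *\<^sub>R X) \<in> G"
  shows "Vector_Spaces.linear smul smul (drep X)"
proof (unfold_locales)
  note der = one_parameter_curve_derivative_0[OF X]
  show "drep X (v + w) = drep X v + drep X w" for v w
    using has_curve_derivative_add[OF der[of v] der[of w]] der[of "v + w"] rep_add[OF X]
    by (intro has_curve_derivative_unique) simp_all
  show "drep X (smul c w) = smul c (drep X w)" for c w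
    using has_curve_derivative_scale[OF der[of w]] der[of "smul c w"] rep_scale[OF X]
    by (intro has_curve_derivative_unique) simp_all
qed

text \<open>The norm of a vector is bounded by the sum of its frame coordinates, and it bounds each of them. The
first estimate makes the weak derivative a derivative in norm, the second makes the limit in norm
unique.\<close>

lemma lie_rep_eq:
  assumes X: "\<And>t :: real. mexp (t *\<^sub>R X) \<in> G"
  shows "lie_rep smul ip \<pi> X w = drep X w"
  unfolding lie_rep_def
proof (rule the_equality)
  define q where "q t = smul (inverse (of_real t)) (\<pi> (mexp (t *\<^sub>R X)) w - \<pi> (mat 1) w)" for t :: real
  have q: "((\<lambda>t. ip a (q t)) \<longlongrightarrow> ip a (drep X w)) (at 0)" for a
  proof -
    have "((\<lambda>t. ip a (\<pi> (mexp (t *\<^sub>R X)) w)) has_vector_derivative ip a (drep X w)) (at 0)"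
      using one_parameter_curve_derivative_0[OF X] by (simp add: has_curve_derivative_def)
    from has_vector_derivative_imp_quotient_tendsto[OF this]
    have "((\<lambda>t. (ip a (\<pi> (mexp (t *\<^sub>R X)) w) - ip a (\<pi> (mat 1) w)) /\<^sub>R t) \<longlongrightarrow> ip a (drep X w)) (at 0)"
      by simp
    then show ?thesis
      by (simp add: q_def ip_scale_right ip_diff_right scaleR_conv_of_real)
  qed
  show "((\<lambda>t. hnorm ip (q t - drep X w)) \<longlongrightarrow> 0) (at 0)"
  proof (rule Lim_null_comparison)
    show "((\<lambda>t. \<Sum>b\<in>parseval_frame. norm (ip b (q t - drep X w))) \<longlongrightarrow> 0) (at 0)"
      using q by (intro tendsto_null_sum) (simp add: ip_diff_right tendsto_norm_zero_iff LIM_zero)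
    show "\<forall>\<^sub>F t in at 0. norm (hnorm ip (q t - drep X w)) \<le> (\<Sum>b\<in>parseval_frame. norm (ip b (q t - drep X w)))"
      using hnorm_le_sum hnorm_nonneg by (intro always_eventually) simp
  qed
  fix w'
  assume w': "((\<lambda>t. hnorm ip (q t - w')) \<longlongrightarrow> 0) (at 0)"
  have "ip b w' = ip b (drep X w)" if "b \<in> parseval_frame" for b
  proof (rule tendsto_unique[OF _ _ q])
    have "((\<lambda>t. ip b (q t - w')) \<longlongrightarrow> 0) (at 0)"
      by (rule Lim_null_comparison[OF _ w']) (use norm_ip_frame_le[OF that] in \<open>auto intro: always_eventually\<close>)
    then show "((\<lambda>t. ip b (q t)) \<longlongrightarrow> ip b w') (at 0)"
      by (simp add: ip_diff_right LIM_zero_cancel)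
  qed simp
  then have "(\<Sum>b\<in>parseval_frame. smul (ip b w') b) = (\<Sum>b\<in>parseval_frame. smul (ip b (drep X w)) b)"
    by simp
  then show "w' = drep X w"
    by (simp only: frame_expansion)
qed

lemma iLie_in_G: "H \<in> iLie K \<Longrightarrow> mexp (t *\<^sub>R H) \<in> G"
  using mexp_iLie_in_group[OF symmetric] .

text \<open>For \<open>X \<in> Lie(K)\<close>, differentiating \<open>\<langle>\<pi>(e\<^sup>t\<^sup>X) x, \<pi>(e\<^sup>t\<^sup>X) y\<rangle> = \<langle>x, y\<rangle>\<close> shows that \<open>\<Pi>(X)\<close> is
skew-Hermitian, and \<open>\<Pi>(\<i>X) = \<i> \<Pi>(X)\<close>.\<close>

lemma drep_hermitian:
  assumes "H \<in> iLie K"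
  shows "ip (drep H x) y = ip x (drep H y)"
proof -
  obtain X where X: "X \<in> Lie_alg K" "H = cscale \<i> X"
    using assms by (rule iLieE)
  have K: "mexp (t *\<^sub>R X) \<in> K" for t
    using X(1) by (simp add: Lie_alg_def)
  then have G: "mexp (t *\<^sub>R X) \<in> G" for t
    by blast
  have "((\<lambda>t. ip (\<pi> (mexp (t *\<^sub>R X)) x) (\<pi> (mexp (t *\<^sub>R X)) y)) has_vector_derivative
      ip (drep X x) y + ip x (drep X y)) (at 0)"
    using has_curve_derivative_ip[OF one_parameter_curve_derivative_0[OF G, of x] one_parameter_curve_derivative_0[OF G, of y]]
    by (simp add: rep_one)
  then have "((\<lambda>t :: real. ip x y) has_vector_derivative ip (drep X x) y + ip x (drep X y)) (at 0)"
    by (simp add: invariant[OF K])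
  then have "ip (drep X x) y + ip x (drep X y) = 0"
    using has_vector_derivative_const vector_derivative_at by metis
  then have "ip (drep X x) y = - ip x (drep X y)"
    by (simp add: eq_neg_iff_add_eq_0)
  then show ?thesis
    by (simp add: X(2) drep_cscale_i ip_scale_left ip_scale_right)
qed

text \<open>By homogeneity this reduces to \<open>\<parallel>H\<parallel> = 1\<close>. What remains is that the supremum defining \<open>N(\<pi>)\<close> is
taken over a bounded set: the matrix entries of \<open>\<Pi>(H)\<close> are bounded linear functions of \<open>H\<close>.\<close>

lemma drep_le_weight_norm:
  assumes H: "H \<in> iLie K"
  shows "hnorm ip (drep H x) \<le> weight_norm smul ip K \<pi> * norm H * hnorm ip x"
proof (cases "H = 0")
  case True
  then show ?thesis
    using drep_linear(2)[of 0 0 x] by simp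
next
  case False
  let ?C = "\<Sum>t\<in>parseval_frame. \<Sum>s\<in>parseval_frame. onorm (frechet_derivative (coefficient t s) (at (mat 1)))"
  have lie_rep: "lie_rep smul ip \<pi> H' = drep H'" if "H' \<in> iLie K" for H'
    using lie_rep_eq[OF iLie_in_G[OF that]] by (simp add: fun_eq_iff)
  have bound: "hop_norm ip (drep H') \<le> ?C" if H': "H' \<in> iLie K" "norm H' = 1" for H'
  proof (rule hop_norm_le)
    have entry: "norm (ip t (drep H' s)) \<le> onorm (frechet_derivative (coefficient t s) (at (mat 1)))" for t s
    proof -
      have "((\<lambda>r. ip t (\<pi> (mexp (r *\<^sub>R H')) s)) has_vector_derivative ip t (drep H' s)) (at 0)"
        using one_parameter_curve_derivative_0[OF iLie_in_G[OF H'(1)]] by (simp add: has_curve_derivative_def)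
      moreover have "((\<lambda>r. ip t (\<pi> (mexp (r *\<^sub>R H')) s)) has_vector_derivative
          frechet_derivative (coefficient t s) (at (mat 1)) H') (at 0)"
        using rational_along_mexp_has_vector_derivative[OF coefficient_rational[of t s], of H']
        by (simp add: coefficient_eq[OF iLie_in_G[OF H'(1)]])
      ultimately have "ip t (drep H' s) = frechet_derivative (coefficient t s) (at (mat 1)) H'"
        by (metis vector_derivative_at)
      then show ?thesis
        using onorm[OF bounded_linear_dcoefficient[of t s], of H'] H'(2) by simp
    qed
    show "hnorm ip (drep H' x) \<le> ?C * hnorm ip x" for x
      by (rule order_trans[OF hnorm_linear_le[OF linear_drep[OF iLie_in_G[OF H'(1)]]]])
        (intro mult_right_mono sum_mono entry hnorm_nonneg)
    show "0 \<le> ?C"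
      by (intro sum_nonneg onorm_pos_le bounded_linear_dcoefficient)
  qed
  define H1 where "H1 = inverse (norm H) *\<^sub>R H"
  have H1: "H1 \<in> iLie K" "norm H1 = 1"
    using H False subspace_iLie[OF symmetric] by (auto simp: H1_def Real_Vector_Spaces.subspace_scale)
  have "hop_norm ip (lie_rep smul ip \<pi> H1) \<le> weight_norm smul ip K \<pi>"
    unfolding weight_norm_def using H1 bound lie_rep by (intro cSUP_upper bdd_aboveI2[of _ _ ?C]) auto
  then have N: "hop_norm ip (drep H1) \<le> weight_norm smul ip K \<pi>"
    by (simp add: lie_rep H1)
  have "H = norm H *\<^sub>R H1"
    using False by (simp add: H1_def)
  then have "drep H x = smul (of_real (norm H)) (drep H1 x)"
    by (metis drep_linear(2))
  then have "hnorm ip (drep H x) = norm H * hnorm ip (drep H1 x)"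
    by (simp add: hnorm_scale)
  also have "\<dots> \<le> norm H * (hop_norm ip (drep H1) * hnorm ip x)"
    by (intro mult_left_mono le_hop_norm linear_drep iLie_in_G H1) simp
  also have "\<dots> \<le> norm H * (weight_norm smul ip K \<pi> * hnorm ip x)"
    by (intro mult_left_mono mult_right_mono N hnorm_nonneg) simp
  finally show ?thesis
    by (simp add: mult_ac)
qed

section \<open>Derivatives of the log-norm along geodesics\<close>

text \<open>The variance of the observable \<open>\<Pi>(H)\<close> in the state \<open>x / \<parallel>x\<parallel>\<close>, for \<open>H \<in> i Lie(K)\<close>,
written for the unnormalised vector \<open>x\<close> as differentiation produces it.\<close>

definition state_variance :: "complex^'n^'n \<Rightarrow> 'v \<Rightarrow> real" where
  "state_variance H x = (hnorm ip (drep H x) / hnorm ip x)\<^sup>2 - (Re (ip x (drep H x)) / (hnorm ip x)\<^sup>2)\<^sup>2"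

text \<open>With \<open>q = \<parallel>x\<parallel>\<^sup>2\<close>, \<open>r = \<langle>x, \<Pi>x\<rangle>\<close> and \<open>p = \<parallel>\<Pi>x\<parallel>\<^sup>2\<close> for \<open>\<Pi> = \<Pi>(H)\<close>, hermiticity gives \<open>q' = 2r\<close> and
\<open>r' = 2p\<close>. The function is \<open>(log q) / 2\<close>, so its derivatives are \<open>r/q\<close> and \<open>2 (p/q - (r/q)\<^sup>2)\<close>.\<close>

lemma log_norm_derivatives:
  assumes H: "H \<in> iLie K" and g: "g \<in> G" and v: "v \<noteq> 0"
  shows log_norm_first_derivative:
      "(along (log_norm_orbit ip \<pi> v) H g has_real_derivative
        Re (ip (\<pi> (mexp (t *\<^sub>R H) ** g) v) (drep H (\<pi> (mexp (t *\<^sub>R H) ** g) v)))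
          / (hnorm ip (\<pi> (mexp (t *\<^sub>R H) ** g) v))\<^sup>2) (at t)"
    and log_norm_second_derivative:
      "((\<lambda>t. Re (ip (\<pi> (mexp (t *\<^sub>R H) ** g) v) (drep H (\<pi> (mexp (t *\<^sub>R H) ** g) v)))
          / (hnorm ip (\<pi> (mexp (t *\<^sub>R H) ** g) v))\<^sup>2) has_real_derivative
        2 * state_variance H (\<pi> (mexp (t *\<^sub>R H) ** g) v)) (at t)"
proof -
  define x where "x t = \<pi> (mexp (t *\<^sub>R H) ** g) v" for t :: real
  define q r p where "q t = (hnorm ip (x t))\<^sup>2" and "r t = Re (ip (x t) (drep H (x t)))"
    and "p t = (hnorm ip (drep H (x t)))\<^sup>2" for t
  note inG = iLie_in_G[OF H]
  have x: "x t = \<pi> (mexp (t *\<^sub>R H)) (\<pi> g v)" for t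
    using rep_mult[OF inG g] by (simp add: x_def)
  have q_pos: "q t > 0" for t
    unfolding q_def x_def by (intro zero_less_power hnorm_pos rep_nonzero mult_in_G inG g v)
  have dx: "has_curve_derivative x (drep H (x t)) t" for t
    unfolding x by (rule one_parameter_curve_derivative[OF inG])
  have dLx: "has_curve_derivative (\<lambda>t. drep H (x t)) (drep H (drep H (x t))) t" for t
    unfolding has_curve_derivative_def
  proof
    fix a
    have "((\<lambda>t. ip (drep H a) (x t)) has_vector_derivative ip (drep H a) (drep H (x t))) (at t)"
      using dx[of t] by (simp add: has_curve_derivative_def)
    then show "((\<lambda>t. ip a (drep H (x t))) has_vector_derivative ip a (drep H (drep H (x t)))) (at t)"
      by (simp add: drep_hermitian[OF H])
  qed
  have Re: "((\<lambda>t. Re (f t)) has_real_derivative Re f') (at t)"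
    if "(f has_vector_derivative f') (at t)" for f f' and t :: real
    using bounded_linear.has_vector_derivative[OF bounded_linear_Re that]
    by (simp add: has_real_derivative_iff_has_vector_derivative)
  have q': "(q has_real_derivative 2 * r t) (at t)" for t
    using Re[OF has_curve_derivative_ip[OF dx[of t] dx[of t]]]
    by (simp add: q_def[abs_def] r_def ip_self drep_hermitian[OF H])
  have r': "(r has_real_derivative 2 * p t) (at t)" for t
    using Re[OF has_curve_derivative_ip[OF dx[of t] dLx[of t]]]
    unfolding r_def[abs_def] p_def by (simp add: ip_self drep_hermitian[OF H, symmetric])
  have "along (log_norm_orbit ip \<pi> v) H g = (\<lambda>t. ln (q t) / 2)"
    using hnorm_pos[OF rep_nonzero[OF mult_in_G[OF inG g] v]]
    by (simp add: fun_eq_iff along_def log_norm_orbit_def q_def x_def ln_realpow)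
  moreover have "((\<lambda>t. ln (q t) / 2) has_real_derivative r t / q t) (at t)"
    using q_pos[of t] by (auto intro!: derivative_eq_intros q')
  ultimately show "(along (log_norm_orbit ip \<pi> v) H g has_real_derivative
        Re (ip (\<pi> (mexp (t *\<^sub>R H) ** g) v) (drep H (\<pi> (mexp (t *\<^sub>R H) ** g) v)))
          / (hnorm ip (\<pi> (mexp (t *\<^sub>R H) ** g) v))\<^sup>2) (at t)"
    by (simp add: q_def r_def x_def)
  have "((\<lambda>t. r t / q t) has_real_derivative (2 * p t * q t - r t * (2 * r t)) / (q t * q t)) (at t)"
    using q_pos[of t] by (intro DERIV_divide r' q') simp
  moreover have "(2 * p t * q t - r t * (2 * r t)) / (q t * q t) = 2 * (p t / q t - (r t / q t)\<^sup>2)"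
    using q_pos[of t] by (simp add: field_simps power2_eq_square)
  ultimately have "((\<lambda>t. r t / q t) has_real_derivative 2 * (p t / q t - (r t / q t)\<^sup>2)) (at t)"
    by metis
  then show "((\<lambda>t. Re (ip (\<pi> (mexp (t *\<^sub>R H) ** g) v) (drep H (\<pi> (mexp (t *\<^sub>R H) ** g) v)))
          / (hnorm ip (\<pi> (mexp (t *\<^sub>R H) ** g) v))\<^sup>2) has_real_derivative
        2 * state_variance H (\<pi> (mexp (t *\<^sub>R H) ** g) v)) (at t)"
    by (simp add: q_def r_def p_def x_def state_variance_def power_divide)
qed

lemma deriv_log_norm:
  assumes "H \<in> iLie K" "g \<in> G" "v \<noteq> 0"
  shows "deriv (along (log_norm_orbit ip \<pi> v) H g) =
    (\<lambda>t. Re (ip (\<pi> (mexp (t *\<^sub>R H) ** g) v) (drep H (\<pi> (mexp (t *\<^sub>R H) ** g) v)))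
          / (hnorm ip (\<pi> (mexp (t *\<^sub>R H) ** g) v))\<^sup>2)"
  using log_norm_first_derivative[OF assms] by (intro ext DERIV_imp_deriv)

lemma deriv_deriv_log_norm:
  assumes "H \<in> iLie K" "g \<in> G" "v \<noteq> 0"
  shows "deriv (deriv (along (log_norm_orbit ip \<pi> v) H g)) t = 2 * state_variance H (\<pi> (mexp (t *\<^sub>R H) ** g) v)"
  unfolding deriv_log_norm[OF assms] by (rule DERIV_imp_deriv[OF log_norm_second_derivative[OF assms]])

lemma twice_differentiable_log_norm:
  assumes "v \<noteq> 0"
  shows "twice_differentiable_along G K (log_norm_orbit ip \<pi> v)"
  unfolding twice_differentiable_along_def
proof (intro ballI allI conjI)
  fix H g t
  assume Hg: "H \<in> iLie K" "g \<in> G"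
  show "along (log_norm_orbit ip \<pi> v) H g differentiable at t"
    using log_norm_first_derivative[OF Hg assms] unfolding real_differentiable_def by blast
  show "deriv (along (log_norm_orbit ip \<pi> v) H g) differentiable at t"
    using log_norm_second_derivative[OF Hg assms] unfolding real_differentiable_def deriv_log_norm[OF Hg assms]
    by blast
qed

lemma left_invariant_log_norm: "left_invariant G K (log_norm_orbit ip \<pi> v)"
  unfolding left_invariant_def
proof (intro ballI)
  fix k g
  assume k: "k \<in> K" and g: "g \<in> G"
  then have "\<pi> (k ** g) v = \<pi> k (\<pi> g v)"
    by (simp add: rep_mult)
  then show "log_norm_orbit ip \<pi> v (k ** g) = log_norm_orbit ip \<pi> v g"
    by (simp add: log_norm_orbit_def hnorm_def invariant[OF k])
qed

abbreviation unit_vector :: "'v \<Rightarrow> 'v" where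
  "unit_vector x \<equiv> smul (inverse (of_real (hnorm ip x))) x"

lemma hnorm_unit_vector: "x \<noteq> 0 \<Longrightarrow> hnorm ip (unit_vector x) = 1"
  using hnorm_pos[of x] by (simp add: hnorm_scale norm_inverse)

lemma drep_scale: "H \<in> iLie K \<Longrightarrow> drep H (smul c x) = smul c (drep H x)"
proof -
  assume "H \<in> iLie K"
  then interpret L: Vector_Spaces.linear smul smul "drep H"
    by (intro linear_drep iLie_in_G)
  show ?thesis by (rule L.scale)
qed

lemma state_variance_unit_vector:
  assumes H: "H \<in> iLie K" and x: "x \<noteq> 0"
  shows "state_variance H x = (hnorm ip (drep H (unit_vector x)))\<^sup>2 - (Re (ip (unit_vector x) (drep H (unit_vector x))))\<^sup>2"
  using hnorm_pos[OF x]
  by (simp add: state_variance_def drep_scale[OF H] hnorm_scale norm_inverse ip_scale_left ip_scale_right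
      norm_divide field_simps power2_eq_square)

lemma state_variance_bounds:
  assumes H: "H \<in> iLie K" and x: "x \<noteq> 0"
  shows "0 \<le> state_variance H x" "state_variance H x \<le> (weight_norm smul ip K \<pi>)\<^sup>2 * (norm H)\<^sup>2"
proof -
  let ?u = "unit_vector x"
  have u: "hnorm ip ?u = 1"
    by (rule hnorm_unit_vector[OF x])
  have "\<bar>Re (ip ?u (drep H ?u))\<bar> \<le> hnorm ip (drep H ?u)"
    using abs_Re_le_cmod norm_ip_unit_le[OF u] by (rule order_trans)
  then show "0 \<le> state_variance H x"
    using power_mono[of "\<bar>Re (ip ?u (drep H ?u))\<bar>" _ 2] by (simp add: state_variance_unit_vector[OF H x])
  have "(hnorm ip (drep H ?u))\<^sup>2 \<le> (weight_norm smul ip K \<pi> * norm H)\<^sup>2"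
    using drep_le_weight_norm[OF H, of ?u] u hnorm_nonneg by (intro power_mono) simp_all
  then show "state_variance H x \<le> (weight_norm smul ip K \<pi>)\<^sup>2 * (norm H)\<^sup>2"
    unfolding state_variance_unit_vector[OF H x] power_mult_distrib
    by (smt (verit) zero_le_power2)
qed

lemma state_variance_eq:
  assumes H: "H \<in> iLie K" and x: "x \<noteq> 0"
  defines "u \<equiv> unit_vector x"
  shows "complex_of_real (state_variance H x) = ip u (drep H (drep H u)) - (ip u (drep H u))\<^sup>2"
proof -
  have "ip u (drep H u) = cnj (ip u (drep H u))"
    using ip_commute[of u "drep H u"] drep_hermitian[OF H, of u u] by simp
  then have "ip u (drep H u) = of_real (Re (ip u (drep H u)))"
    by (metis Reals_cnj_iff of_real_Re)
  moreover have "ip u (drep H (drep H u)) = of_real ((hnorm ip (drep H u))\<^sup>2)"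
    using drep_hermitian[OF H, of u "drep H u"] by (simp add: ip_self)
  ultimately show ?thesis
    unfolding state_variance_unit_vector[OF H x, folded u_def] by (metis of_real_diff of_real_power)
qed

text \<open>The covariance of \<open>\<Pi>(X)\<close> and \<open>\<Pi>(Y)\<close> in the state \<open>u\<close>, which polarises the variance.\<close>

definition state_covariance :: "'v \<Rightarrow> complex^'n^'n \<Rightarrow> complex^'n^'n \<Rightarrow> real" where
  "state_covariance u X Y = Re (ip (drep X u) (drep Y u)) - Re (ip u (drep X u)) * Re (ip u (drep Y u))"

lemma bilinear_state_covariance: "bilinear (state_covariance u)"
  unfolding bilinear_def
  by (auto intro!: linearI simp: state_covariance_def drep_linear ip_add_left ip_add_right ip_scale_left ip_scale_right
      algebra_simps)

lemma state_covariance_diagonal: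
  assumes "H \<in> iLie K" "x \<noteq> 0"
  shows "state_covariance (unit_vector x) H H = state_variance H x"
  by (simp add: state_variance_unit_vector[OF assms] state_covariance_def ip_self) (simp add: power2_eq_square)
end

section \<open>Symmetric tensors and quadratic forms\<close>

lemma tensor2_apply: "tensor2 x y z = (y \<bullet> z) *\<^sub>R x"
  by (simp add: tensor2_def)

lemma blinfun_apply_sum: "blinfun_apply (\<Sum>i\<in>I. A i) x = (\<Sum>i\<in>I. A i x)"
  by (induction I rule: infinite_finite_induct) (simp_all add: blinfun.add_left)

text \<open>The spanning squares are self-adjoint and this survives linear combination. Consequently \<open>tr(A\<^sup>2)\<close>
is the squared Hilbert-Schmidt norm, which drives the uniqueness proof below.\<close>

lemma Sym2_self_adjoint:
  assumes "A \<in> Sym2 W"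
  shows "x \<bullet> A y = A x \<bullet> y"
  using assms unfolding Sym2_def
proof (induction rule: span_induct_alt)
  case base
  then show ?case by simp
next
  case (step c B A)
  then show ?case
    by (auto simp: blinfun.add_left blinfun.scaleR_left inner_add_left inner_add_right tensor2_apply inner_commute mult_ac)
qed

text \<open>The difference \<open>D\<close> pairs to zero under the trace with all squares \<open>H \<otimes> H\<close>, hence with their span, to
which \<open>D\<close> itself belongs. So \<open>tr(D\<^sup>2) = 0\<close>, and \<open>D\<close> is self-adjoint.\<close>

lemma Sym2_eqI:
  assumes A: "A \<in> Sym2 W" and B: "B \<in> Sym2 W"
    and eq: "\<And>H. H \<in> W \<Longrightarrow> H \<bullet> A H = H \<bullet> B H"
  shows "A = B"
proof -
  define D where "D = A - B"
  have D: "D \<in> Sym2 W"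
    using A B unfolding D_def Sym2_def by (rule span_diff)
  have "op_trace (D o\<^sub>L C) = 0" if "C \<in> Sym2 W" for C
    using that unfolding Sym2_def
  proof (induction rule: span_induct_alt)
    case base
    then show ?case by (simp add: op_trace_def)
  next
    case (step c T C)
    then obtain H where H: "H \<in> W" "T = tensor2 H H" by blast
    have "op_trace (D o\<^sub>L T) = 0"
      using eq[OF H(1)] by (simp add: H(2) op_trace_tensor2 D_def blinfun.diff_left inner_diff_right)
    moreover have "op_trace (D o\<^sub>L (c *\<^sub>R T + C)) = c * op_trace (D o\<^sub>L T) + op_trace (D o\<^sub>L C)"
      by (simp add: op_trace_def blinfun.add_left blinfun.scaleR_left blinfun.add_right blinfun.scaleR_right
          inner_add_right sum.distrib sum_distrib_left)
    ultimately show ?case using step by simp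
  qed
  then have "op_trace (D o\<^sub>L D) = 0"
    using D by blast
  moreover have "op_trace (D o\<^sub>L D) = (\<Sum>b\<in>Basis. D b \<bullet> D b)"
    unfolding op_trace_def
    by (intro sum.cong refl) (simp add: Sym2_self_adjoint[OF D, of _ "blinfun_apply D _"])
  ultimately have "(\<Sum>b\<in>Basis. D b \<bullet> D b) = 0"
    by simp
  then have "\<forall>b\<in>Basis. D b = 0"
    by (simp add: sum_nonneg_eq_0_iff)
  then have "D = 0"
    by (intro blinfun_euclidean_eqI) simp
  then show ?thesis
    by (simp add: D_def)
qed

text \<open>In an orthonormal basis of \<open>W\<close> the tensor is \<open>\<Sum> b(e, e') e \<otimes> e'\<close>, symmetrised. The sum
\<open>S e e' = e \<otimes> e' + e' \<otimes> e\<close> is written through squares so that it visibly lies in the span.\<close>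

lemma Sym2_representing_form:
  fixes W :: "'a::euclidean_space set"
  assumes W: "subspace W" and b: "bilinear b"
  obtains A where "A \<in> Sym2 W" "\<And>H. H \<in> W \<Longrightarrow> H \<bullet> A H = b H H"
proof -
  obtain E where E: "E \<subseteq> W" "pairwise orthogonal E" "\<And>x. x \<in> E \<Longrightarrow> norm x = 1" "finite E" "span E = W"
    using orthonormal_basis_subspace[OF W] independent_imp_finite by metis
  define S where "S e e' = tensor2 (e + e') (e + e') - tensor2 e e - tensor2 e' e'" for e e' :: 'a
  have S_apply: "H \<bullet> S e e' H = 2 * ((e \<bullet> H) * (e' \<bullet> H))" for e e' H
    by (simp add: S_def blinfun.diff_left blinfun.add_left tensor2_apply inner_diff_right inner_add_left inner_add_right inner_commute algebra_simps)
  define A where "A = (\<Sum>e\<in>E. \<Sum>e'\<in>E. (b e e' / 2) *\<^sub>R S e e')"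
  have "S e e' \<in> Sym2 W" if "e \<in> E" "e' \<in> E" for e e'
    using that E(1) W unfolding S_def Sym2_def
    by (intro span_diff span_base) (auto intro: subspace_add)
  then have "A \<in> Sym2 W"
    unfolding A_def Sym2_def by (intro span_sum span_scale)
  moreover have "H \<bullet> A H = b H H" if "H \<in> W" for H
  proof -
    have H: "H = (\<Sum>e\<in>E. (e \<bullet> H) *\<^sub>R e)"
    proof -
      define y where "y = H - (\<Sum>e\<in>E. (e \<bullet> H) *\<^sub>R e)"
      have "y \<in> W"
        unfolding y_def using that E(1) W by (intro subspace_diff subspace_sum subspace_scale) auto
      \<comment> \<open>the defect of the expansion lies in \<open>W\<close> and is orthogonal to \<open>W\<close>\<close>
      have "y \<bullet> f = 0" if "f \<in> E" for f
      proof -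
        have "(\<Sum>e\<in>E. (e \<bullet> H) * (e \<bullet> f)) = (\<Sum>e\<in>E. if e = f then f \<bullet> H else 0)"
          using E(2,3) that
          by (intro sum.cong) (auto simp: pairwise_def orthogonal_def dot_square_norm)
        then show ?thesis
          using that E(4) by (simp add: y_def inner_diff_left inner_sum_left inner_commute[of H f])
      qed
      then have "orthogonal y y"
        using \<open>y \<in> W\<close> E(5) orthogonal_to_span[of y E] by (auto simp: orthogonal_def)
      then show ?thesis
        by (simp add: y_def orthogonal_def)
    qed
    have "H \<bullet> A H = (\<Sum>e\<in>E. \<Sum>e'\<in>E. b e e' * ((e \<bullet> H) * (e' \<bullet> H)))"
      by (simp add: A_def blinfun_apply_sum blinfun.scaleR_left inner_sum_right S_apply)
    also have "\<dots> = b (\<Sum>e\<in>E. (e \<bullet> H) *\<^sub>R e) (\<Sum>e\<in>E. (e \<bullet> H) *\<^sub>R e)"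
      by (simp add: bilinear_sum[OF b] bilinear_lmul[OF b] bilinear_rmul[OF b] sum.cartesian_product split_def mult_ac)
    finally show ?thesis
      using H by simp
  qed
  ultimately show ?thesis
    by (rule that)
qed

lemma bilinear_cmult:
  fixes b :: "'a::real_vector \<Rightarrow> 'b::real_vector \<Rightarrow> real"
  assumes "bilinear b"
  shows "bilinear (\<lambda>x y. c * b x y)"
  unfolding bilinear_def
  by (auto intro!: linearI simp: bilinear_ladd[OF assms] bilinear_radd[OF assms]
      bilinear_lmul[OF assms] bilinear_rmul[OF assms] algebra_simps)

lemma is_geodesic_hessian_geodesic_hessian:
  assumes "subspace (iLie K)" "bilinear b"
    and "\<And>H. H \<in> iLie K \<Longrightarrow> deriv (deriv (along F H g)) 0 = b H H"
  shows "is_geodesic_hessian K F g (geodesic_hessian K F g)"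
proof -
  obtain A where A: "A \<in> Sym2 (iLie K)" "\<And>H. H \<in> iLie K \<Longrightarrow> H \<bullet> A H = b H H"
    using Sym2_representing_form[OF assms(1,2)] by blast
  have "is_geodesic_hessian K F g A"
    using A assms(3) by (simp add: is_geodesic_hessian_def op_trace_tensor2)
  moreover have "A' = A" if "is_geodesic_hessian K F g A'" for A'
    using that A assms(3)
    by (intro Sym2_eqI[of A' "iLie K"]) (simp_all add: is_geodesic_hessian_def op_trace_tensor2)
  ultimately show ?thesis
    unfolding geodesic_hessian_def by (rule theI)
qed

section \<open>Convexity, smoothness and Hessian of the log-norm\<close>

theorem proposition3p13:
  fixes G K :: "(complex^'n^'n) set"
    and smul :: "complex \<Rightarrow> 'v::ab_group_add \<Rightarrow> 'v"
    and B :: "'v set"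
    and ip :: "'v \<Rightarrow> 'v \<Rightarrow> complex"
    and \<pi> :: "complex^'n^'n \<Rightarrow> 'v \<Rightarrow> 'v"
    and v :: 'v
  assumes "symmetric_subgroup G"
    and "K = G \<inter> unitary_group"
    and "hermitian_space smul B ip"
    and "rational_representation smul B G \<pi>"
    and "\<And>k x y. k \<in> K \<Longrightarrow> ip (\<pi> k x) (\<pi> k y) = ip x y"
    and "v \<noteq> 0"
  shows
    "geodesically_convex G K (log_norm_orbit ip \<pi> v) \<and>
     geodesically_smooth G K (2 * (weight_norm smul ip K \<pi>)\<^sup>2) (log_norm_orbit ip \<pi> v) \<and>
     (\<forall>g\<in>G.
        is_geodesic_hessian K (log_norm_orbit ip \<pi> v) g
          (geodesic_hessian K (log_norm_orbit ip \<pi> v) g) \<and>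
        (\<forall>H\<in>iLie K.
           let u = smul (inverse (of_real (hnorm ip (\<pi> g v)))) (\<pi> g v);
               P = lie_rep smul ip \<pi>
           in of_real (op_trace (geodesic_hessian K (log_norm_orbit ip \<pi> v) g o\<^sub>L tensor2 H H))
              = 2 * (ip u (P H (P H u)) - (ip u (P H u))\<^sup>2)))"
proof -
  let ?F = "log_norm_orbit ip \<pi> v"
  interpret hermitian_space smul B ip by fact
  interpret U: unitary_representation smul B ip G \<pi>
    using assms by unfold_locales auto
  note K = assms(2)
  have nonzero: "\<pi> (mexp (t *\<^sub>R H) ** g) v \<noteq> 0" if "H \<in> iLie K" "g \<in> G" for t H g
    using that assms(6) unfolding K by (intro U.rep_nonzero U.mult_in_G U.iLie_in_G)
  have second: "deriv (deriv (along ?F H g)) t = 2 * U.state_variance H (\<pi> (mexp (t *\<^sub>R H) ** g) v)"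
    if "H \<in> iLie K" "g \<in> G" for t H g
    using that assms(6) unfolding K by (rule U.deriv_deriv_log_norm)
  have bounds: "0 \<le> deriv (deriv (along ?F H g)) t"
    "\<bar>deriv (deriv (along ?F H g)) t\<bar> \<le> 2 * (weight_norm smul ip K \<pi>)\<^sup>2 * (norm H)\<^sup>2"
    if "H \<in> iLie K" "g \<in> G" for t H g
    using U.state_variance_bounds[OF that(1)[unfolded K] nonzero[OF that, of t]] K
    by (simp_all add: second[OF that])
  have regular: "left_invariant G K ?F" "twice_differentiable_along G K ?F"
    unfolding K using U.left_invariant_log_norm U.twice_differentiable_log_norm assms(6) by auto
  have convex: "geodesically_convex G K ?F"
    and smooth: "geodesically_smooth G K (2 * (weight_norm smul ip K \<pi>)\<^sup>2) ?F"
    using regular bounds by (simp_all add: geodesically_convex_def geodesically_smooth_def)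
  have second_0: "deriv (deriv (along ?F H g)) 0 = 2 * U.state_variance H (\<pi> g v)"
    if "H \<in> iLie K" "g \<in> G" for H g
    using second[OF that, of 0] by simp
  have hessian: "is_geodesic_hessian K ?F g (geodesic_hessian K ?F g)" if g: "g \<in> G" for g
  proof (rule is_geodesic_hessian_geodesic_hessian)
    show "Real_Vector_Spaces.subspace (iLie K)"
      unfolding K using assms(1) by (rule subspace_iLie)
    show "bilinear (\<lambda>X Y. 2 * U.state_covariance (U.unit_vector (\<pi> g v)) X Y)"
      by (rule bilinear_cmult[OF U.bilinear_state_covariance])
    show "deriv (deriv (along ?F H g)) 0 = 2 * U.state_covariance (U.unit_vector (\<pi> g v)) H H" if "H \<in> iLie K" for H
      using second_0[OF that g] U.state_covariance_diagonal[OF that[unfolded K] U.rep_nonzero[OF g assms(6)]] by simp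
  qed
  have formula: "of_real (op_trace (geodesic_hessian K ?F g o\<^sub>L tensor2 H H))
      = 2 * (ip u (P H (P H u)) - (ip u (P H u))\<^sup>2)"
    if g: "g \<in> G" and H: "H \<in> iLie K" and u: "u = U.unit_vector (\<pi> g v)" and P: "P = lie_rep smul ip \<pi>" for g H u P
  proof -
    have "P H = U.drep H"
      unfolding P using U.lie_rep_eq[OF U.iLie_in_G[OF H[unfolded K]]] by (simp add: fun_eq_iff)
    moreover have "op_trace (geodesic_hessian K ?F g o\<^sub>L tensor2 H H) = 2 * U.state_variance H (\<pi> g v)"
      using hessian[OF g] H second_0[OF H g] by (simp add: is_geodesic_hessian_def)
    ultimately show ?thesis
      using U.state_variance_eq[OF H[unfolded K] U.rep_nonzero[OF g assms(6)]] by (simp add: u)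
  qed
  show ?thesis
    using convex smooth hessian formula by (simp add: Let_def)
qed

end
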